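(* Let $G$ be a finite connected regular simple graph with edge set $E$ and constant edge degree $d'(e)=2q\ge 4$ for all $e\in E$ (so every vertex has degree $q+1$). There is a constant $C_G>0$ depending only on $G$ such that for every function $f:E\to\mathbb{R}$ there is a number $\beta_{\max}\in\{\tfrac1q\}\cup[q^{-1/2},1)$ such that both of the following hold with these same constants: (i) for every directed edge $a$ in $G$ and every integer $r\ge 0$, $\big|M_{r,a}(f)-\frac{1}{|E|}\sum_{e\in E}f(e)\big|\le C_G\|f\|_2\beta_{\max}^{\,r}$; (ii) for every (nonempty) finite connected subgraph $X$ of the universal covering tree $\widetilde G$ and every integer $r\ge 0$, $$\Big|\frac{1}{|\mathcal{T}'_r(X)|}\sum_{e\in\mathcal{T}'_r(X)}\tilde f(e)-\frac{1}{|E|}\sum_{e\in E}f(e)\Big|\le C_G\,\|f\|_2\,\beta_{\max}^{\,r}.$$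
   Context: Simple means no loops and no multiple edges. The edge degree $d'(e)$ is the number of edges meeting $e$ in either of its endpoints. The norm is $\|f\|_2=\langle f,f\rangle^{1/2}$ with $\langle f,g\rangle=\sum_{e\in E}f(e)g(e)$. Universal cover: $\widetilde G$ is the universal covering tree of $G$, with vertex set $\widetilde V$ and edge set $\widetilde E$: fix a root vertex of $G$; the vertices of $\widetilde G$ are the non-backtracking paths in $G$ starting at the root, two being adjacent if they differ by exactly one edge at the end. The projection $\pi:\widetilde G\to G$ sends a path to its end vertex, and $\pi(\{\tilde v,\tilde w\})=\{\pi(\tilde v),\pi(\tilde w)\}$ on edges. The lift of $f$ is $\tilde f=f\circ\pi$. $\delta$ is the combinatorial distance between vertices. Edge spheres and arcs: for $v_0\in\widetilde V$, $S'_r(v_0)=\{e=\{x,y\}\in\widetilde E:\min\{\delta(x,v_0),\delta(y,v_0)\}=r\}$. For a directed edge $a$ of $\widetilde G$ from $w'$ to $w$, $A'_0(a)=\{a\}$ and $A'_{r+1}(a)=S'_{r+1}(w')\cap S'_r(w)$ for $r\ge0$, and $M_{r,a}(f)=\frac{1}{|A'_r(a)|}\sum_{x\in A'_r(a)}\tilde f(x)$. For a directed edge $a$ of $G$, $M_{r,a}(f)$ is computed using any lift of $a$ to $\widetilde G$ (the value does not depend on the lift). Tubes: for a finite connected subgraph $X$ of $\widetilde G$ with vertex set $V(X)$, the edge tube of radius $r$ around $X$ is $\mathcal{T}'_r(X)=\{e=\{x,y\}\in\widetilde E:\min_{z\in V(X)}\min\{\delta(x,z),\delta(y,z)\}=r\}$.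 The constant $C_G$ does not depend on $a$, $X$, $f$, $r$; the rate $\beta_{\max}$ may depend on $G$ and $f$ but not on $a$, $X$ or $r$. *)

theory Defs
  imports "HOL-Analysis.L2_Norm"
begin

section \<open>Simple graphs\<close>

text \<open>A graph is given by a vertex set and a set of two-element vertex sets, so there are no
  loops and no multiple edges. It may be infinite, as the universal cover is.\<close>

definition simple_graph :: "'v set \<Rightarrow> 'v set set \<Rightarrow> bool" where
  "simple_graph V E \<longleftrightarrow> (\<forall>e\<in>E. e \<subseteq> V \<and> card e = 2)"

definition directed_edges :: "'v set set \<Rightarrow> ('v \<times> 'v) set" where
  "directed_edges E = {(u, w). {u, w} \<in> E}"

definition connected_graph :: "'v set \<Rightarrow> 'v set set \<Rightarrow> bool" where
  "connected_graph V E \<longleftrightarrow> V \<noteq> {} \<and> (\<forall>u\<in>V. \<forall>w\<in>V. (u, w) \<in> (directed_edges E)\<^sup>*)"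

definition vertex_degree :: "'v set set \<Rightarrow> 'v \<Rightarrow> nat" where
  "vertex_degree E v = card {e \<in> E. v \<in> e}"

definition regular_graph :: "'v set \<Rightarrow> 'v set set \<Rightarrow> bool" where
  "regular_graph V E \<longleftrightarrow> (\<exists>k. \<forall>v\<in>V. vertex_degree E v = k)"

text \<open>The edge itself is not counted: in a graph that is regular of degree \<open>q + 1\<close>, the edge
  degree is \<open>2 * q\<close>.\<close>

definition edge_degree :: "'v set set \<Rightarrow> 'v set \<Rightarrow> nat" where
  "edge_degree E e = card {e' \<in> E. e' \<noteq> e \<and> e' \<inter> e \<noteq> {}}"

text \<open>The distance is meaningful only for vertices in the same component.\<close>

definition graph_dist :: "'v set set \<Rightarrow> 'v \<Rightarrow> 'v \<Rightarrow> nat" where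
  "graph_dist E x y = (LEAST n. (x, y) \<in> directed_edges E ^^ n)"


section \<open>Edge spheres, arcs and tubes\<close>

definition edge_sphere :: "'v set set \<Rightarrow> nat \<Rightarrow> 'v \<Rightarrow> 'v set set" where
  "edge_sphere E r v =
     {e \<in> E. \<exists>x y. e = {x, y} \<and> min (graph_dist E x v) (graph_dist E y v) = r}"

text \<open>The pair \<open>(w', w)\<close> is the edge directed from \<open>w'\<close> to \<open>w\<close>.\<close>

fun edge_arc :: "'v set set \<Rightarrow> nat \<Rightarrow> 'v \<times> 'v \<Rightarrow> 'v set set" where
  "edge_arc E 0 (w', w) = {{w', w}}"
| "edge_arc E (Suc r) (w', w) = edge_sphere E (Suc r) w' \<inter> edge_sphere E r w"

text \<open>The argument \<open>X\<close> is the vertex set of the subgraph, assumed finite and nonempty.\<close>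

definition edge_tube :: "'v set set \<Rightarrow> nat \<Rightarrow> 'v set \<Rightarrow> 'v set set" where
  "edge_tube E r X =
     {e \<in> E. \<exists>x y. e = {x, y} \<and>
        (MIN z\<in>X. min (graph_dist E x z) (graph_dist E y z)) = r}"

text \<open>A subgraph is given by its own vertex and edge sets.\<close>

definition finite_connected_subgraph ::
  "'v set \<Rightarrow> 'v set set \<Rightarrow> 'v set \<Rightarrow> 'v set set \<Rightarrow> bool" where
  "finite_connected_subgraph X F V E \<longleftrightarrow>
     X \<subseteq> V \<and> F \<subseteq> E \<and> simple_graph X F \<and> finite X \<and> connected_graph X F"

definition edge_mean :: "('v set \<Rightarrow> real) \<Rightarrow> 'v set set \<Rightarrow> real" where
  "edge_mean f A = (\<Sum>e\<in>A. f e) / real (card A)"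


section \<open>The universal cover\<close>

text \<open>A path is the list of its vertices, starting at the root \<open>v0\<close>; \<open>[v0]\<close> is the trivial path.\<close>

definition cover_verts :: "'v set \<Rightarrow> 'v set set \<Rightarrow> 'v \<Rightarrow> 'v list set" where
  "cover_verts V E v0 =
     {p. p \<noteq> [] \<and> set p \<subseteq> V \<and> hd p = v0 \<and> successively (\<lambda>u w. {u, w} \<in> E) p \<and>
         (\<forall>i. i + 2 < length p \<longrightarrow> p ! i \<noteq> p ! (i + 2))}"

definition cover_edges :: "'v set \<Rightarrow> 'v set set \<Rightarrow> 'v \<Rightarrow> 'v list set set" where
  "cover_edges V E v0 =
     {{p, p @ [w]} | p w. p \<in> cover_verts V E v0 \<and> p @ [w] \<in> cover_verts V E v0}"

text \<open>The projection to the base graph is \<open>last\<close> on vertices and its image on edges.\<close>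

definition lift_fun :: "('v set \<Rightarrow> real) \<Rightarrow> 'v list set \<Rightarrow> real" where
  "lift_fun f e = f (last ` e)"

definition lifts :: "'v set \<Rightarrow> 'v set set \<Rightarrow> 'v \<Rightarrow> 'v \<times> 'v \<Rightarrow> ('v list \<times> 'v list) set" where
  "lifts V E v0 a =
     {b \<in> directed_edges (cover_edges V E v0). map_prod last last b = a}"

definition arc_mean ::
  "'v set \<Rightarrow> 'v set set \<Rightarrow> 'v \<Rightarrow> nat \<Rightarrow> 'v list \<times> 'v list \<Rightarrow> ('v set \<Rightarrow> real) \<Rightarrow> real" where
  "arc_mean V E v0 r b f = edge_mean (lift_fun f) (edge_arc (cover_edges V E v0) r b)"

lemma cover_step:
  assumes p: "p \<in> cover_verts V E v0" and "simple_graph V E" and e: "{last p, w} \<in> E"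
  shows "\<exists>p'\<in>cover_verts V E v0. last p' = w \<and> {p, p'} \<in> cover_edges V E v0"
proof -
  have wV: "w \<in> V" using assms unfolding simple_graph_def by auto
  show ?thesis
  proof (cases "length p \<ge> 2 \<and> p ! (length p - 2) = w")
    case True
    define p' where "p' = butlast p"
    have "p = p' @ [last p]"
      using p unfolding p'_def cover_verts_def by simp
    moreover have "p' \<noteq> []"
    proof
      assume "p' = []"
      then have "length p \<le> 1" unfolding p'_def by (cases p) (auto split: if_splits)
      then show False using True by simp
    qed
    moreover have "last p' = w"
      using True \<open>p' \<noteq> []\<close> unfolding p'_def by (auto simp: last_conv_nth nth_butlast numeral_2_eq_2)
    moreover have "p' \<in> cover_verts V E v0"
    proof -
      obtain x where x: "p = p' @ [x]" using calculation by blast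
      have "\<forall>i. i + 2 < length p' \<longrightarrow> p' ! i \<noteq> p' ! (i + 2)"
      proof (intro allI impI)
        fix i assume i: "i + 2 < length p'"
        then have "p ! i \<noteq> p ! (i + 2)" using p x unfolding cover_verts_def by auto
        then show "p' ! i \<noteq> p' ! (i + 2)" using i x by (simp add: nth_append)
      qed
      then show ?thesis using p x \<open>p' \<noteq> []\<close>
        unfolding cover_verts_def by (auto simp: successively_append_iff)
    qed
    ultimately show ?thesis using p unfolding cover_edges_def
      by (smt (verit) insert_commute mem_Collect_eq)
  next
    case False
    have "p @ [w] \<in> cover_verts V E v0"
    proof -
      have "(p @ [w]) ! i \<noteq> (p @ [w]) ! (i + 2)" if i: "i + 2 < length (p @ [w])" for i
      proof (cases "i + 2 < length p")
        case True
        then show ?thesis using p unfolding cover_verts_def by (auto simp: nth_append)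
      next
        case F: False
        then have l: "i + 2 = length p" using i by simp
        then have "length p - 2 = i" "length p \<ge> 2" by auto
        then have "p ! i \<noteq> w" using False by metis
        then show ?thesis using l by (simp add: nth_append)
      qed
      then show ?thesis using p e wV
        unfolding cover_verts_def by (auto simp: successively_append_iff)
    qed
    then show ?thesis using p unfolding cover_edges_def by (intro bexI[of _ "p @ [w]"]) auto
  qed
qed

lemma lifts_nonempty:
  assumes sg: "simple_graph V E" and "connected_graph V E" "v0 \<in> V" "a \<in> directed_edges E"
  shows "lifts V E v0 a \<noteq> {}"
proof -
  obtain u w where a: "a = (u, w)" "{u, w} \<in> E"
    using assms(4) unfolding directed_edges_def by auto
  then have "u \<in> V" using sg unfolding simple_graph_def by auto
  then have "(v0, u) \<in> (directed_edges E)\<^sup>*"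
    using assms unfolding connected_graph_def by auto
  then have "\<exists>p\<in>cover_verts V E v0. last p = u"
  proof (induction rule: rtrancl_induct)
    case base
    have "[v0] \<in> cover_verts V E v0" using assms unfolding cover_verts_def by auto
    then show ?case by force
  next
    case (step y z)
    then obtain p where "p \<in> cover_verts V E v0" "{last p, z} \<in> E"
      unfolding directed_edges_def by auto
    then show ?case using cover_step[OF _ sg] by blast
  qed
  then show ?thesis
    using cover_step[OF _ sg] a unfolding lifts_def directed_edges_def by fastforce
qed

end

theory Submission
  imports Defs "HOL-Library.Sublist"
begin

text \<open>
  Non-backtracking walks carry the proof. Let \<open>A\<close> be the operator that replaces a function \<open>g\<close> of
  directed edges of the graph by its mean over the \<open>q\<close> non-backtracking continuations of an edge.

  In a tree, walks that leave a connected set \<open>X\<close> and never backtrack move away from \<open>X\<close> at every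
  step. Hence the tube of radius \<open>r > 0\<close> around \<open>X\<close> is the set of last edges of such walks of \<open>r\<close>
  steps beyond the boundary of \<open>X\<close>, each reached exactly once, and an arc is the set of last edges
  of those starting with one given edge (\<open>edge_tube_Suc\<close>, \<open>edge_arc_eq\<close>). As the covering map is
  a local isomorphism, the mean of the lift of \<open>f\<close> over such a set is the mean of \<open>A\<^sup>r f\<close> over the
  projected starting edges (\<open>cover_level_mean\<close>). Both estimates thus follow from one bound on
  \<open>A\<^sup>r g\<close> in the supremum norm, where \<open>g\<close> is \<open>f\<close> minus its mean.

  Rates arbitrarily close to \<open>1\<close> are admitted, so any exponential decay that is uniform in \<open>g\<close>
  suffices, and one rate serves for all \<open>f\<close>.
  The operator does not increase the \<open>L\<^sup>2\<close> norm, and the loss in one step is governed by the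
  variances of \<open>g\<close> on the edges out of each vertex (\<open>energy_nb_avg\<close>). If nothing is lost in two
  steps, then \<open>g (v, w)\<close> depends on \<open>v\<close> only, and takes the same value at any two vertices with a
  common neighbour; in a connected graph the remaining functions are the constants and, if the
  graph is bipartite, those that depend only on the side of \<open>v\<close>. A centred function of undirected edges
  is orthogonal to all of them (\<open>even_balanced_symmetric\<close>), \<open>A\<close> preserves this orthogonality, and
  on the orthogonal complement the loss in two steps is a fixed proportion of the norm
  (\<open>two_step_gap\<close>). This gives exponential decay (\<open>nb_avg_decay\<close>).
\<close>


section \<open>The non-backtracking averaging operator\<close>

definition nbrs :: "'v set set \<Rightarrow> 'v \<Rightarrow> 'v set" where
  "nbrs E v = {w. {v, w} \<in> E}"

definition nb_step :: "'v set set \<Rightarrow> (('v \<times> 'v) \<times> ('v \<times> 'v)) set" where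
  "nb_step E = {((y, z), (z', x)). z' = z \<and> {y, z} \<in> E \<and> {z, x} \<in> E \<and> x \<noteq> y}"

text \<open>On a \<open>(q + 1)\<close>-regular graph every directed edge has exactly \<open>q\<close> successors, so this is the
  transition operator of the non-backtracking walk.\<close>

definition nb_avg :: "'v set set \<Rightarrow> nat \<Rightarrow> ('v \<times> 'v \<Rightarrow> real) \<Rightarrow> 'v \<times> 'v \<Rightarrow> real" where
  "nb_avg E q g a = (\<Sum>b \<in> nb_step E `` {a}. g b) / real q"

definition out_sum :: "'v set set \<Rightarrow> ('v \<times> 'v \<Rightarrow> real) \<Rightarrow> 'v \<Rightarrow> real" where
  "out_sum E g v = (\<Sum>w\<in>nbrs E v. g (v, w))"

definition energy :: "'v set \<Rightarrow> 'v set set \<Rightarrow> ('v \<times> 'v \<Rightarrow> real) \<Rightarrow> real" where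
  "energy V E g = (\<Sum>v\<in>V. \<Sum>w\<in>nbrs E v. (g (v, w))\<^sup>2)"

text \<open>These are the functions that are constant along walks of even length. On a connected graph they
  are the constants, and on a bipartite one also the functions that are constant on each side.\<close>

definition even_invariant :: "'v set set \<Rightarrow> ('v \<Rightarrow> real) \<Rightarrow> bool" where
  "even_invariant E \<phi> \<longleftrightarrow> (\<forall>u w w'. {u, w} \<in> E \<longrightarrow> {u, w'} \<in> E \<longrightarrow> \<phi> w = \<phi> w')"

text \<open>Orthogonality to the functions \<open>(v, w) \<mapsto> \<phi> v\<close> with \<open>\<phi>\<close> even-invariant. On the span of these
  functions two steps of the walk act as the identity, so decay can only be expected on the
  orthogonal complement. The condition covers bipartite and non-bipartite graphs alike.\<close>

definition even_balanced :: "'v set \<Rightarrow> 'v set set \<Rightarrow> ('v \<times> 'v \<Rightarrow> real) \<Rightarrow> bool" where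
  "even_balanced V E g \<longleftrightarrow>
     (\<forall>\<phi>. even_invariant E \<phi> \<longrightarrow> (\<Sum>v\<in>V. \<phi> v * out_sum E g v) = 0)"

locale finite_regular_graph =
  fixes V :: "'v set" and E :: "'v set set" and q :: nat
  assumes finite_V: "finite V"
    and simple: "simple_graph V E"
    and conn: "connected_graph V E"
    and card_nbrs: "v \<in> V \<Longrightarrow> card (nbrs E v) = Suc q"
    and q_ge2: "q \<ge> 2"
begin

lemma edge_in_V: "{u, w} \<in> E \<Longrightarrow> u \<in> V \<and> w \<in> V"
  using simple by (auto simp: simple_graph_def)

lemma nbrs_subset: "nbrs E v \<subseteq> V"
  using edge_in_V by (auto simp: nbrs_def)

lemma finite_nbrs: "finite (nbrs E v)"
  using nbrs_subset finite_V by (rule finite_subset)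

lemma directed_edges_Sigma: "directed_edges E = Sigma V (nbrs E)"
  using edge_in_V by (auto simp: directed_edges_def nbrs_def)

lemma finite_directed: "finite (directed_edges E)"
  unfolding directed_edges_Sigma using finite_V finite_nbrs by auto

lemma finite_E: "finite E"
  using simple finite_V by (intro finite_subset[of E "Pow V"]) (auto simp: simple_graph_def)

lemma sum_nbrs_directed:
  "(\<Sum>v\<in>V. \<Sum>w\<in>nbrs E v. F (v, w)) = (\<Sum>a\<in>directed_edges E. F a)"
  unfolding directed_edges_Sigma by (subst sum.Sigma) (auto simp: finite_V finite_nbrs)

lemma sum_nbrs_swap:
  "(\<Sum>v\<in>V. \<Sum>w\<in>nbrs E v. F v w) = (\<Sum>w\<in>V. \<Sum>v\<in>nbrs E w. F v w)"
proof -
  have N: "nbrs E v = {w\<in>V. {v, w} \<in> E}" for v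
    using edge_in_V by (auto simp: nbrs_def)
  have N': "nbrs E w = {v. v \<in> V \<and> {v, w} \<in> E}" for w
    using edge_in_V by (auto simp: nbrs_def insert_commute)
  show ?thesis
    by (subst N, subst N', rule sum.swap_restrict[OF finite_V finite_V])
qed

lemma nb_avg_eq:
  assumes "{u, w} \<in> E"
  shows "nb_avg E q g (u, w) = (out_sum E g w - g (w, u)) / real q"
proof -
  have *: "nb_step E `` {(u, w)} = Pair w ` (nbrs E w - {u})"
    using assms by (auto simp: nb_step_def nbrs_def)
  have u: "u \<in> nbrs E w"
    using assms by (simp add: nbrs_def insert_commute)
  have "(\<Sum>b \<in> nb_step E `` {(u, w)}. g b) = (\<Sum>x\<in>nbrs E w - {u}. g (w, x))"
    unfolding * by (subst sum.reindex) (auto simp: inj_on_def)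
  also have "\<dots> = out_sum E g w - g (w, u)"
    unfolding out_sum_def using sum.remove[OF finite_nbrs u, of "\<lambda>x. g (w, x)"] by simp
  finally show ?thesis by (simp add: nb_avg_def)
qed

lemma nb_avg_funpow_const:
  assumes "a \<in> directed_edges E"
  shows "(nb_avg E q ^^ r) (\<lambda>_. c) a = c"
  using assms
proof (induction r arbitrary: a)
  case (Suc r)
  obtain u w where a: "a = (u, w)" by (cases a)
  with Suc.prems have e: "{u, w} \<in> E" by (simp add: directed_edges_def)
  then have "w \<in> V" using edge_in_V by blast
  have "out_sum E ((nb_avg E q ^^ r) (\<lambda>_. c)) w = (\<Sum>x\<in>nbrs E w. c)"
    unfolding out_sum_def
    by (intro sum.cong refl Suc.IH) (simp add: directed_edges_def nbrs_def)
  also have "\<dots> = (real q + 1) * c" using card_nbrs[OF \<open>w \<in> V\<close>] by (simp add: algebra_simps)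
  finally have "out_sum E ((nb_avg E q ^^ r) (\<lambda>_. c)) w = (real q + 1) * c" .
  moreover have "(nb_avg E q ^^ r) (\<lambda>_. c) (w, u) = c"
    using e by (intro Suc.IH) (simp add: directed_edges_def insert_commute)
  ultimately show ?case
    unfolding a using nb_avg_eq[OF e, of "(nb_avg E q ^^ r) (\<lambda>_. c)"] q_ge2
    by (simp add: field_simps)
qed simp

end


section \<open>Decay of the averages\<close>

context finite_regular_graph
begin

definition out_mean :: "('v \<times> 'v \<Rightarrow> real) \<Rightarrow> 'v \<Rightarrow> real" where
  "out_mean g v = out_sum E g v / (real q + 1)"

definition out_var :: "('v \<times> 'v \<Rightarrow> real) \<Rightarrow> 'v \<Rightarrow> real" where
  "out_var g v = (\<Sum>w\<in>nbrs E v. (g (v, w) - out_mean g v)\<^sup>2)"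

lemma out_var_eq:
  assumes "v \<in> V"
  shows "out_var g v = (\<Sum>w\<in>nbrs E v. (g (v, w))\<^sup>2) - (out_sum E g v)\<^sup>2 / (real q + 1)"
proof -
  have "out_var g v = (\<Sum>w\<in>nbrs E v. (g (v, w))\<^sup>2) - 2 * out_mean g v * out_sum E g v
      + (real q + 1) * (out_mean g v)\<^sup>2"
    using card_nbrs[OF assms]
    by (simp add: out_var_def power2_diff sum.distrib sum_subtractf out_sum_def sum_distrib_left
        algebra_simps)
  also have "\<dots> = (\<Sum>w\<in>nbrs E v. (g (v, w))\<^sup>2) - (out_sum E g v)\<^sup>2 / (real q + 1)"
  proof -
    have "- 2 * (s / c) * s + c * (s / c)\<^sup>2 = - (s\<^sup>2 / c)" if "c \<noteq> 0" for s c :: real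
      using that by (simp add: power2_eq_square field_simps)
    from this[of "real q + 1" "out_sum E g v"] show ?thesis
      unfolding out_mean_def by linarith
  qed
  finally show ?thesis .
qed

text \<open>The operator splits into one block per vertex \<open>w\<close>, from the values on the edges out of \<open>w\<close> to
  those on the edges into \<open>w\<close>, with matrix \<open>(J - I) / q\<close> where \<open>J\<close> is the all-ones matrix. It is the
  identity on constants and \<open>- 1 / q\<close> on functions of sum zero, so exactly the variance around
  each vertex is damped.\<close>

lemma energy_nb_avg:
  "energy V E (nb_avg E q g) = energy V E g - (1 - 1 / (real q)\<^sup>2) * (\<Sum>v\<in>V. out_var g v)"
proof -
  have "energy V E (nb_avg E q g) = (\<Sum>w\<in>V. \<Sum>u\<in>nbrs E w. (nb_avg E q g (u, w))\<^sup>2)"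
    unfolding energy_def by (rule sum_nbrs_swap)
  also have "\<dots> = (\<Sum>w\<in>V. (\<Sum>x\<in>nbrs E w. (g (w, x))\<^sup>2) - (1 - 1 / (real q)\<^sup>2) * out_var g w)"
  proof (rule sum.cong[OF refl])
    fix w assume w: "w \<in> V"
    define s where "s = out_sum E g w"
    define Q where "Q = (\<Sum>x\<in>nbrs E w. (g (w, x))\<^sup>2)"
    have "(\<Sum>u\<in>nbrs E w. (nb_avg E q g (u, w))\<^sup>2)
        = (\<Sum>u\<in>nbrs E w. (s - g (w, u))\<^sup>2 / (real q)\<^sup>2)"
      by (intro sum.cong refl)
        (simp add: nb_avg_eq nbrs_def insert_commute s_def power_divide)
    also have "\<dots> = ((real q + 1) * s\<^sup>2 - 2 * s * s + Q) / (real q)\<^sup>2"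
    proof -
      have "(\<Sum>u\<in>nbrs E w. 2 * s * g (w, u)) = 2 * s * s"
        by (simp add: sum_distrib_left[symmetric] s_def out_sum_def)
      then have "(\<Sum>u\<in>nbrs E w. (s - g (w, u))\<^sup>2) = (real q + 1) * s\<^sup>2 - 2 * s * s + Q"
        using card_nbrs[OF w] by (simp add: power2_diff sum.distrib sum_subtractf Q_def)
      then show ?thesis by (simp add: sum_divide_distrib[symmetric])
    qed
    also have "\<dots> = Q - (1 - 1 / (real q)\<^sup>2) * (Q - s\<^sup>2 / (real q + 1))"
    proof -
      have "((c + 1) * s\<^sup>2 - 2 * s * s + Q) / c\<^sup>2 = Q - (1 - 1 / c\<^sup>2) * (Q - s\<^sup>2 / (c + 1))"
        if "c > 0" for c :: real
      proof -
        have "(1 - 1 / c\<^sup>2) * (s\<^sup>2 / (c + 1)) = (c - 1) * s\<^sup>2 / c\<^sup>2"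
          using that by (simp add: power2_eq_square divide_simps) algebra
        moreover have "Q - (1 - 1 / c\<^sup>2) * Q = Q / c\<^sup>2" by (simp add: algebra_simps)
        moreover have "((c + 1) * s\<^sup>2 - 2 * s * s + Q) / c\<^sup>2 = (c - 1) * s\<^sup>2 / c\<^sup>2 + Q / c\<^sup>2"
          by (simp add: add_divide_distrib[symmetric] power2_eq_square algebra_simps)
        ultimately show ?thesis by (simp add: right_diff_distrib)
      qed
      then show ?thesis using q_ge2 by simp
    qed
    finally show "(\<Sum>u\<in>nbrs E w. (nb_avg E q g (u, w))\<^sup>2)
        = (\<Sum>x\<in>nbrs E w. (g (w, x))\<^sup>2) - (1 - 1 / (real q)\<^sup>2) * out_var g w"
      by (simp add: out_var_eq[OF w] Q_def s_def)
  qed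
  also have "\<dots> = energy V E g - (1 - 1 / (real q)\<^sup>2) * (\<Sum>v\<in>V. out_var g v)"
    by (simp add: energy_def sum_subtractf sum_distrib_left)
  finally show ?thesis .
qed

lemma out_var_nonneg: "out_var g v \<ge> 0"
  by (simp add: out_var_def sum_nonneg)

lemma contraction_const_nonneg: "1 - 1 / (real q)\<^sup>2 > 0"
proof -
  have "1 < real q" using q_ge2 by simp
  then have "1 < (real q)\<^sup>2" by (simp add: one_less_power)
  then show ?thesis using q_ge2 by (simp add: divide_simps)
qed

lemma energy_nonneg: "energy V E g \<ge> 0"
  by (simp add: energy_def sum_nonneg)

lemma energy_nb_avg_le: "energy V E (nb_avg E q g) \<le> energy V E g"
  unfolding energy_nb_avg
  using contraction_const_nonneg by (simp add: sum_nonneg out_var_nonneg)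

lemma sq_le_energy:
  assumes "a \<in> directed_edges E"
  shows "(g a)\<^sup>2 \<le> energy V E g"
proof -
  have "(g a)\<^sup>2 \<le> (\<Sum>a\<in>directed_edges E. (g a)\<^sup>2)"
    by (rule member_le_sum[OF assms]) (auto simp: finite_directed)
  also have "\<dots> = energy V E g"
    unfolding energy_def using sum_nbrs_directed[of "\<lambda>a. (g a)\<^sup>2"] by simp
  finally show ?thesis .
qed

text \<open>Moving by one edge is well defined on even-invariant functions, because all neighbours of a
  vertex carry the same value.\<close>

lemma even_invariant_shift:
  assumes "even_invariant E \<phi>"
  obtains \<psi> where "even_invariant E \<psi>" "\<And>u w. {u, w} \<in> E \<Longrightarrow> \<psi> u = \<phi> w"
proof
  define \<psi> where "\<psi> u = \<phi> (SOME w. {u, w} \<in> E)" for u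
  show *: "\<psi> u = \<phi> w" if "{u, w} \<in> E" for u w
    using assms someI[of "\<lambda>w. {u, w} \<in> E", OF that] that
    unfolding even_invariant_def \<psi>_def by blast
  show "even_invariant E \<psi>"
    unfolding even_invariant_def using * by (metis insert_commute)
qed

text \<open>Pairing the average with \<open>\<phi>\<close> is the same as pairing the original function with the shift of \<open>\<phi>\<close>,
  which is again even-invariant.\<close>

lemma even_balanced_nb_avg:
  assumes "even_balanced V E g"
  shows "even_balanced V E (nb_avg E q g)"
  unfolding even_balanced_def
proof (intro allI impI)
  fix \<phi> assume \<phi>: "even_invariant E \<phi>"
  obtain \<psi> where \<psi>: "even_invariant E \<psi>" "\<And>u w. {u, w} \<in> E \<Longrightarrow> \<psi> u = \<phi> w"
    using even_invariant_shift[OF \<phi>] by blast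
  have "(\<Sum>v\<in>V. \<phi> v * out_sum E (nb_avg E q g) v)
      = (\<Sum>v\<in>V. \<Sum>w\<in>nbrs E v. \<phi> v * nb_avg E q g (v, w))"
    by (simp add: out_sum_def sum_distrib_left)
  also have "\<dots> = (\<Sum>w\<in>V. \<Sum>v\<in>nbrs E w. \<phi> v * nb_avg E q g (v, w))"
    by (rule sum_nbrs_swap)
  also have "\<dots> = (\<Sum>w\<in>V. \<psi> w * out_sum E g w)"
  proof (rule sum.cong[OF refl])
    fix w assume w: "w \<in> V"
    have "(\<Sum>v\<in>nbrs E w. \<phi> v * nb_avg E q g (v, w))
        = (\<Sum>v\<in>nbrs E w. \<psi> w * ((out_sum E g w - g (w, v)) / real q))"
    proof (rule sum.cong[OF refl])
      fix v assume "v \<in> nbrs E w"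
      then have "{w, v} \<in> E" "{v, w} \<in> E" by (auto simp: nbrs_def insert_commute)
      then show "\<phi> v * nb_avg E q g (v, w) = \<psi> w * ((out_sum E g w - g (w, v)) / real q)"
        using \<psi>(2) by (simp add: nb_avg_eq)
    qed
    also have "\<dots> = \<psi> w * (((real q + 1) * out_sum E g w - out_sum E g w) / real q)"
      using card_nbrs[OF w]
      by (simp add: sum_distrib_left[symmetric] sum_divide_distrib[symmetric] sum_subtractf
          out_sum_def algebra_simps)
    also have "\<dots> = \<psi> w * out_sum E g w" using q_ge2 by (simp add: algebra_simps)
    finally show "(\<Sum>v\<in>nbrs E w. \<phi> v * nb_avg E q g (v, w)) = \<psi> w * out_sum E g w" .
  qed
  also have "\<dots> = 0" using assms \<psi>(1) by (simp add: even_balanced_def)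
  finally show "(\<Sum>v\<in>V. \<phi> v * out_sum E (nb_avg E q g) v) = 0" .
qed

text \<open>For a function of undirected edges, the pairings with \<open>\<phi>\<close> and with its shift \<open>\<psi>\<close> agree. Their
  sum is a pairing with \<open>\<phi> + \<psi>\<close>, which takes equal values at the two ends of every edge and is
  therefore constant on a connected graph. This is why the sign character of a bipartite graph
  does not obstruct convergence for undirected edges.\<close>

lemma even_balanced_symmetric:
  assumes sym: "\<And>u w. {u, w} \<in> E \<Longrightarrow> g (u, w) = g (w, u)"
    and total: "(\<Sum>v\<in>V. out_sum E g v) = 0"
  shows "even_balanced V E g"
  unfolding even_balanced_def
proof (intro allI impI)
  fix \<phi> assume \<phi>: "even_invariant E \<phi>"
  obtain \<psi> where \<psi>: "\<And>u w. {u, w} \<in> E \<Longrightarrow> \<psi> u = \<phi> w"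
    using even_invariant_shift[OF \<phi>] by blast
  obtain v0 where v0: "v0 \<in> V" using conn by (auto simp: connected_graph_def)
  have const: "\<phi> v + \<psi> v = \<phi> v0 + \<psi> v0" if "v \<in> V" for v
  proof -
    have "(v0, v) \<in> (directed_edges E)\<^sup>*"
      using conn v0 that by (auto simp: connected_graph_def)
    then show ?thesis
    proof (induction rule: rtrancl_induct)
      case (step y z)
      then have "{y, z} \<in> E" by (simp add: directed_edges_def)
      then have "\<psi> y = \<phi> z" "\<psi> z = \<phi> y"
        using \<psi>[of y z] \<psi>[of z y] by (simp_all add: insert_commute)
      with step.IH show ?case by simp
    qed simp
  qed
  have "(\<Sum>v\<in>V. \<phi> v * out_sum E g v) = (\<Sum>v\<in>V. \<Sum>w\<in>nbrs E v. \<phi> v * g (v, w))"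
    by (simp add: out_sum_def sum_distrib_left)
  also have "\<dots> = (\<Sum>w\<in>V. \<Sum>v\<in>nbrs E w. \<phi> v * g (v, w))" by (rule sum_nbrs_swap)
  also have "\<dots> = (\<Sum>w\<in>V. \<psi> w * out_sum E g w)"
    unfolding out_sum_def sum_distrib_left
  proof (intro sum.cong refl)
    fix w v assume "v \<in> nbrs E w"
    then have e: "{w, v} \<in> E" by (simp add: nbrs_def)
    show "\<phi> v * g (v, w) = \<psi> w * g (w, v)" unfolding \<psi>[OF e] sym[OF e] ..
  qed
  finally have "2 * (\<Sum>v\<in>V. \<phi> v * out_sum E g v)
      = (\<Sum>v\<in>V. (\<phi> v + \<psi> v) * out_sum E g v)"
    by (simp add: sum.distrib algebra_simps)
  also have "\<dots> = (\<Sum>v\<in>V. (\<phi> v0 + \<psi> v0) * out_sum E g v)"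
    using const by (intro sum.cong) auto
  also have "\<dots> = 0" using total by (simp add: sum_distrib_left[symmetric])
  finally show "(\<Sum>v\<in>V. \<phi> v * out_sum E g v) = 0" by simp
qed

text \<open>A Poincare inequality in the supremum norm: if \<open>out_mean\<close> varies little between vertices with a
  common neighbour, it varies little on the set of vertices reachable by even walks. There it
  averages to zero, by the balance condition for the indicator of this set, hence it is small.\<close>

lemma even_balanced_local_global:
  obtains N :: nat where
    "\<And>g \<epsilon> v. \<lbrakk>even_balanced V E g; \<epsilon> \<ge> 0;
       \<And>u w w'. {u, w} \<in> E \<Longrightarrow> {u, w'} \<in> E \<Longrightarrow> \<bar>out_mean g w - out_mean g w'\<bar> \<le> \<epsilon>; v \<in> V\<rbrakk>
     \<Longrightarrow> \<bar>out_mean g v\<bar> \<le> real N * \<epsilon>"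
proof
  define R where "R = directed_edges E O directed_edges E"
  define n where "n p = (LEAST k. p \<in> R ^^ k)" for p
  define N where "N = Max (n ` (V \<times> V))"
  fix g \<epsilon> v
  assume bal: "even_balanced V E g" and \<epsilon>: "\<epsilon> \<ge> (0::real)" and v: "v \<in> V"
    and loc: "\<And>u w w'. {u, w} \<in> E \<Longrightarrow> {u, w'} \<in> E \<Longrightarrow> \<bar>out_mean g w - out_mean g w'\<bar> \<le> \<epsilon>"
  have steps: "\<bar>out_mean g x - out_mean g y\<bar> \<le> real k * \<epsilon>" if "(x, y) \<in> R ^^ k" for k x y
    using that
  proof (induction k arbitrary: y)
    case (Suc k)
    then obtain z where z: "(x, z) \<in> R ^^ k" "(z, y) \<in> R" by auto
    then obtain u where "{z, u} \<in> E" "{u, y} \<in> E" by (auto simp: R_def directed_edges_def)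
    then have "\<bar>out_mean g z - out_mean g y\<bar> \<le> \<epsilon>" by (intro loc[of u]) (auto simp: insert_commute)
    with Suc.IH[OF z(1)] show ?case by (simp add: algebra_simps)
  qed simp
  \<comment> \<open>The even class of \<open>v\<close>, whose indicator is even-invariant.\<close>
  define C where "C = {w\<in>V. (v, w) \<in> R\<^sup>*}"
  have C: "finite C" "v \<in> C" "C \<subseteq> V" using finite_V v by (auto simp: C_def)
  have near: "\<bar>out_mean g v - out_mean g w\<bar> \<le> real N * \<epsilon>" if "w \<in> C" for w
  proof -
    have "(v, w) \<in> R\<^sup>*" using that by (simp add: C_def)
    then obtain k where "(v, w) \<in> R ^^ k" by (auto simp: rtrancl_power)
    then have "(v, w) \<in> R ^^ n (v, w)" unfolding n_def by (rule LeastI)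
    then have "\<bar>out_mean g v - out_mean g w\<bar> \<le> real (n (v, w)) * \<epsilon>" by (rule steps)
    also have "n (v, w) \<le> N"
      unfolding N_def using v that C(3) finite_V by (intro Max_ge) auto
    then have "real (n (v, w)) * \<epsilon> \<le> real N * \<epsilon>" using \<epsilon> by (intro mult_right_mono) auto
    finally show ?thesis .
  qed
  have "even_invariant E (\<lambda>w. if (v, w) \<in> R\<^sup>* then 1 else 0)"
    unfolding even_invariant_def
  proof (intro allI impI)
    fix u w w' assume "{u, w} \<in> E" "{u, w'} \<in> E"
    then have "(w, w') \<in> R" "(w', w) \<in> R"
      by (auto simp: R_def directed_edges_def insert_commute relcomp.simps)
    then show "(if (v, w) \<in> R\<^sup>* then 1 else 0 :: real) = (if (v, w') \<in> R\<^sup>* then 1 else 0)"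
      by (auto intro: rtrancl_into_rtrancl)
  qed
  with bal have "(\<Sum>w\<in>V. (if (v, w) \<in> R\<^sup>* then 1 else 0) * out_sum E g w) = 0"
    unfolding even_balanced_def by blast
  then have "(\<Sum>w\<in>C. out_sum E g w) = 0"
    unfolding C_def sum.inter_filter[OF finite_V]
    by (rule trans[rotated]) (intro sum.cong refl, simp)
  then have "(\<Sum>w\<in>C. out_mean g w) = 0"
    by (simp add: out_mean_def sum_divide_distrib[symmetric])
  then have "real (card C) * \<bar>out_mean g v\<bar> = \<bar>\<Sum>w\<in>C. out_mean g v - out_mean g w\<bar>"
    by (simp add: sum_subtractf abs_mult)
  also have "\<dots> \<le> real (card C) * (real N * \<epsilon>)"
    using near by (intro order.trans[OF sum_abs] sum_bounded_above)
  finally show "\<bar>out_mean g v\<bar> \<le> real N * \<epsilon>"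
    using C by (auto simp: mult_le_cancel_left)
qed

lemma out_var_pointwise:
  assumes "{v, w} \<in> E"
  shows "(g (v, w) - out_mean g v)\<^sup>2 \<le> out_var g v"
  unfolding out_var_def using assms finite_nbrs
  by (intro member_le_sum[where f = "\<lambda>w. (g (v, w) - out_mean g v)\<^sup>2"]) (auto simp: nbrs_def)

text \<open>One step alone loses no energy on the functions \<open>(v, w) \<mapsto> h v\<close>. If the variances of both \<open>g\<close>
  and its average are small, then \<open>g (v, w)\<close> is close to \<open>h v\<close> and the average at \<open>(u, w)\<close> is close
  both to \<open>h w\<close> and to a quantity depending on \<open>u\<close> only. So \<open>h\<close> hardly differs at two neighbours
  of \<open>u\<close>, and the balance condition forces it to be small.\<close>

lemma two_step_gap:
  obtains K :: real where "K \<ge> 1"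
    "\<And>g. even_balanced V E g \<Longrightarrow>
       energy V E g \<le> K * ((\<Sum>v\<in>V. out_var g v) + (\<Sum>v\<in>V. out_var (nb_avg E q g) v))"
proof -
  obtain N :: nat where N: "\<And>g \<epsilon> v. \<lbrakk>even_balanced V E g; \<epsilon> \<ge> 0;
       \<And>u w w'. {u, w} \<in> E \<Longrightarrow> {u, w'} \<in> E \<Longrightarrow> \<bar>out_mean g w - out_mean g w'\<bar> \<le> \<epsilon>; v \<in> V\<rbrakk>
     \<Longrightarrow> \<bar>out_mean g v\<bar> \<le> real N * \<epsilon>"
    using even_balanced_local_global by blast
  define K where "K = (1 + real (card (directed_edges E))) * (4 * real N + 1)\<^sup>2"
  have "energy V E g \<le> K * ((\<Sum>v\<in>V. out_var g v) + (\<Sum>v\<in>V. out_var (nb_avg E q g) v))"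
    if bal: "even_balanced V E g" for g
  proof -
    define Tg where "Tg = nb_avg E q g"
    define W where "W = (\<Sum>v\<in>V. out_var g v) + (\<Sum>v\<in>V. out_var Tg v)"
    have W0: "W \<ge> 0" unfolding W_def by (intro add_nonneg_nonneg sum_nonneg out_var_nonneg)
    define \<epsilon> where "\<epsilon> = sqrt W"
    have \<epsilon>: "\<epsilon> \<ge> 0" "\<epsilon>\<^sup>2 = W" using W0 by (auto simp: \<epsilon>_def)
    have var_le: "out_var g v \<le> W" "out_var Tg v \<le> W" if "v \<in> V" for v
    proof -
      have "out_var g v \<le> (\<Sum>v\<in>V. out_var g v)" "out_var Tg v \<le> (\<Sum>v\<in>V. out_var Tg v)"
        by (rule member_le_sum[OF that out_var_nonneg finite_V])+
      moreover have "(\<Sum>v\<in>V. out_var g v) \<ge> 0" "(\<Sum>v\<in>V. out_var Tg v) \<ge> 0"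
        by (auto intro!: sum_nonneg out_var_nonneg)
      ultimately show "out_var g v \<le> W" "out_var Tg v \<le> W" unfolding W_def by linarith+
    qed
    have dev: "\<bar>g (v, w) - out_mean g v\<bar> \<le> \<epsilon>" "\<bar>Tg (v, w) - out_mean Tg v\<bar> \<le> \<epsilon>"
      if e: "{v, w} \<in> E" for v w
    proof -
      have v: "v \<in> V" using edge_in_V[OF e] by simp
      show "\<bar>g (v, w) - out_mean g v\<bar> \<le> \<epsilon>" "\<bar>Tg (v, w) - out_mean Tg v\<bar> \<le> \<epsilon>"
        using order.trans[OF out_var_pointwise[OF e] var_le(1)[OF v]]
          order.trans[OF out_var_pointwise[OF e] var_le(2)[OF v]]
        unfolding \<epsilon>_def by (metis real_sqrt_le_iff real_sqrt_abs)+
    qed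
    have Tg_near: "\<bar>Tg (u, w) - out_mean g w\<bar> \<le> \<epsilon>" if e: "{u, w} \<in> E" for u w
    proof -
      have "out_sum E g w = (real q + 1) * out_mean g w"
        by (simp add: out_mean_def)
      then have "Tg (u, w) - out_mean g w = (out_mean g w - g (w, u)) / real q"
        using q_ge2 by (simp add: Tg_def nb_avg_eq[OF e] field_simps)
      then have "\<bar>Tg (u, w) - out_mean g w\<bar> = \<bar>g (w, u) - out_mean g w\<bar> / real q"
        by (simp add: abs_minus_commute)
      also have "\<dots> \<le> \<bar>g (w, u) - out_mean g w\<bar> / 1"
        using q_ge2 by (intro divide_left_mono) auto
      also have "\<dots> \<le> \<epsilon>" using dev(1)[of w u] e by (simp add: insert_commute)
      finally show ?thesis .
    qed
    have "\<bar>out_mean g w - out_mean g w'\<bar> \<le> 4 * \<epsilon>" if "{u, w} \<in> E" "{u, w'} \<in> E" for u w w'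
      using Tg_near[OF that(1)] Tg_near[OF that(2)] dev(2)[OF that(1)] dev(2)[OF that(2)]
      by linarith
    then have mean: "\<bar>out_mean g v\<bar> \<le> real N * (4 * \<epsilon>)" if "v \<in> V" for v
      using \<epsilon> by (intro N[OF bal _ _ that]) auto
    have "(g a)\<^sup>2 \<le> (4 * real N + 1)\<^sup>2 * W" if a: "a \<in> directed_edges E" for a
    proof -
      obtain v w where vw: "a = (v, w)" "{v, w} \<in> E" using a by (auto simp: directed_edges_def)
      have "\<bar>g a\<bar> \<le> (4 * real N + 1) * \<epsilon>"
        using dev(1)[OF vw(2)] mean[of v] edge_in_V[OF vw(2)] vw(1) by (simp add: algebra_simps)
      then have "\<bar>g a\<bar>\<^sup>2 \<le> ((4 * real N + 1) * \<epsilon>)\<^sup>2" by (intro power_mono) auto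
      then show ?thesis by (simp add: power_mult_distrib \<epsilon>(2))
    qed
    then have "(\<Sum>a\<in>directed_edges E. (g a)\<^sup>2)
        \<le> real (card (directed_edges E)) * ((4 * real N + 1)\<^sup>2 * W)"
      by (intro sum_bounded_above)
    also have "\<dots> \<le> K * W"
      unfolding K_def using W0 by (simp add: algebra_simps)
    also have "(\<Sum>a\<in>directed_edges E. (g a)\<^sup>2) = energy V E g"
      unfolding energy_def using sum_nbrs_directed[of "\<lambda>a. (g a)\<^sup>2"] by simp
    finally show ?thesis by (simp add: W_def Tg_def)
  qed
  moreover have "K \<ge> 1"
  proof -
    have "1 * 1 \<le> (1 + real (card (directed_edges E))) * (4 * real N + 1)\<^sup>2"
      by (intro mult_mono) auto
    then show ?thesis by (simp add: K_def)
  qed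
  ultimately show ?thesis using that by blast
qed

text \<open>Two steps multiply the energy by at most a fixed factor \<open>\<rho> < 1\<close>. The rate is the maximum of the fourth
  root of \<open>\<rho>\<close> (energy is a square, and the factor is for two steps) and \<open>q powr (- 1 / 2)\<close>.\<close>

lemma nb_avg_decay:
  obtains \<beta> :: real where "real q powr (- 1 / 2) \<le> \<beta>" "\<beta> < 1"
    "\<And>g r a. even_balanced V E g \<Longrightarrow> a \<in> directed_edges E \<Longrightarrow>
       \<bar>(nb_avg E q ^^ r) g a\<bar> \<le> real q * \<beta> ^ r * sqrt (energy V E g)"
proof -
  obtain K where K: "K \<ge> 1" "\<And>g. even_balanced V E g \<Longrightarrow>
       energy V E g \<le> K * ((\<Sum>v\<in>V. out_var g v) + (\<Sum>v\<in>V. out_var (nb_avg E q g) v))"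
    using two_step_gap by blast
  define c where "c = 1 - 1 / (real q)\<^sup>2"
  have c: "0 < c" "c \<le> 1" using contraction_const_nonneg by (auto simp: c_def)
  define \<rho> where "\<rho> = 1 - c / K"
  have "c / K \<le> 1" using c K(1) by (simp add: field_simps)
  then have \<rho>: "0 \<le> \<rho>" "\<rho> < 1" using c K(1) by (auto simp: \<rho>_def)
  have two: "energy V E (nb_avg E q (nb_avg E q g)) \<le> \<rho> * energy V E g"
    if "even_balanced V E g" for g
  proof -
    have "energy V E g / K \<le> (\<Sum>v\<in>V. out_var g v) + (\<Sum>v\<in>V. out_var (nb_avg E q g) v)"
      using K(1) K(2)[OF that] by (simp add: field_simps)
    then have "c * (energy V E g / K)
        \<le> c * ((\<Sum>v\<in>V. out_var g v) + (\<Sum>v\<in>V. out_var (nb_avg E q g) v))"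
      using c by (intro mult_left_mono) auto
    then show ?thesis
      unfolding energy_nb_avg[of "nb_avg E q g"] energy_nb_avg[of g] c_def[symmetric] \<rho>_def
      by (simp add: algebra_simps)
  qed
  define \<beta> where "\<beta> = max (real q powr (- 1 / 2)) (root 4 \<rho>)"
  have q1: "real q > 1" using q_ge2 by simp
  have \<beta>1: "\<beta> < 1" using \<rho> q1 by (simp add: \<beta>_def powr_less_one)
  have \<beta>q: "real q powr (- 1 / 2) \<le> \<beta>" by (simp add: \<beta>_def)
  have \<beta>0: "\<beta> > 0" using q1 \<beta>q by (smt (verit) powr_gt_zero)
  have "1 / real q = real q powr (-1)" using q1 by (simp add: powr_minus_divide)
  also have "\<dots> \<le> real q powr (- 1 / 2)" using q1 by (intro powr_mono) auto
  \<comment> \<open>The factor \<open>real q\<close> in the bound absorbs an odd last step: it makes up for one power of \<open>\<beta>\<close>.\<close>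
  also note \<beta>q
  finally have q\<beta>: "1 \<le> real q * \<beta>" using q1 by (simp add: field_simps)
  have \<rho>\<beta>: "\<rho> \<le> \<beta> ^ 4"
  proof -
    have "\<rho> = root 4 \<rho> ^ 4" using \<rho> by simp
    also have "\<dots> \<le> \<beta> ^ 4" using \<rho> by (intro power_mono) (auto simp: \<beta>_def)
    finally show ?thesis .
  qed
  have decay: "energy V E ((nb_avg E q ^^ r) g) \<le> (real q * \<beta> ^ r)\<^sup>2 * energy V E g"
    if "even_balanced V E g" for r g
    using that
  proof (induction r arbitrary: g rule: nat_less_induct)
    case (1 r)
    consider "r = 0" | "r = 1" | s where "r = Suc (Suc s)" by (metis One_nat_def not0_implies_Suc)
    then show ?case
    proof cases
      case 1
      have "1 \<le> (real q)\<^sup>2" using q1 by simp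
      then show ?thesis using 1 energy_nonneg[of g] by (simp add: mult_le_cancel_right1)
    next
      case 2
      have "1 \<le> (real q * \<beta>)\<^sup>2" using q\<beta> by simp
      then have "energy V E g \<le> (real q * \<beta>)\<^sup>2 * energy V E g"
        using energy_nonneg[of g] mult_right_mono[of 1 "(real q * \<beta>)\<^sup>2" "energy V E g"] by simp
      with energy_nb_avg_le[of g] 2 show ?thesis by simp
    next
      case (3 s)
      have "energy V E ((nb_avg E q ^^ r) g)
          = energy V E ((nb_avg E q ^^ s) (nb_avg E q (nb_avg E q g)))"
        by (simp add: 3 funpow_swap1)
      also have "\<dots> \<le> (real q * \<beta> ^ s)\<^sup>2 * energy V E (nb_avg E q (nb_avg E q g))"
        using 1 3 even_balanced_nb_avg by auto
      also have "\<dots> \<le> (real q * \<beta> ^ s)\<^sup>2 * (\<beta> ^ 4 * energy V E g)"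
        using order.trans[OF two[OF "1.prems"] mult_right_mono[OF \<rho>\<beta> energy_nonneg]]
        by (intro mult_left_mono) auto
      also have "\<dots> = (real q * \<beta> ^ r)\<^sup>2 * energy V E g"
        by (simp add: 3 power_mult_distrib power2_eq_square power4_eq_xxxx)
      finally show ?thesis .
    qed
  qed
  have "\<bar>(nb_avg E q ^^ r) g a\<bar> \<le> real q * \<beta> ^ r * sqrt (energy V E g)"
    if "even_balanced V E g" "a \<in> directed_edges E" for g r a
  proof -
    define h where "h = (nb_avg E q ^^ r) g"
    have "(h a)\<^sup>2 \<le> (real q * \<beta> ^ r)\<^sup>2 * energy V E g"
      using sq_le_energy[OF that(2), of h] decay[OF that(1), of r] unfolding h_def by linarith
    moreover have "\<bar>h a\<bar> = sqrt ((h a)\<^sup>2)" by simp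
    ultimately have "\<bar>h a\<bar> \<le> sqrt ((real q * \<beta> ^ r)\<^sup>2 * energy V E g)"
      by (metis real_sqrt_le_mono)
    then show ?thesis using \<beta>0 by (simp add: real_sqrt_mult h_def)
  qed
  with that[OF \<beta>q \<beta>1] show ?thesis by blast
qed

end


section \<open>Non-backtracking walks, tubes and arcs in trees\<close>

definition boundary :: "'v set set \<Rightarrow> 'v set \<Rightarrow> ('v \<times> 'v) set" where
  "boundary T X = {(y, z). {y, z} \<in> T \<and> y \<in> X \<and> z \<notin> X}"

text \<open>The last edges of the non-backtracking walks that start with an edge of \<open>S\<close> and take \<open>r\<close> more
  steps.\<close>

abbreviation nb_level :: "'v set set \<Rightarrow> nat \<Rightarrow> ('v \<times> 'v) set \<Rightarrow> ('v \<times> 'v) set" where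
  "nb_level T r S \<equiv> (nb_step T ^^ r) `` S"

abbreviation undirect :: "('v \<times> 'v) \<Rightarrow> 'v set" where
  "undirect a \<equiv> {fst a, snd a}"

lemma nb_level_Suc: "nb_level T (Suc r) S = (\<Union>a\<in>nb_level T r S. nb_step T `` {a})"
  by (auto simp: relcomp_Image)

lemma sym_directed_edges: "sym (directed_edges T)"
  by (auto simp: sym_def directed_edges_def insert_commute)

text \<open>Every edge of a tree separates it. Here \<open>side y z\<close> is the half tree beyond the edge directed
  from \<open>y\<close> to \<open>z\<close>. The axioms express acyclicity in the only form that the distance arguments
  below use: a walk leaves a half tree only through its edge, and half trees shrink along
  non-backtracking walks.\<close>

locale half_tree_graph =
  fixes U :: "'a set" and T :: "'a set set" and side :: "'a \<Rightarrow> 'a \<Rightarrow> 'a set"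
  assumes simple: "simple_graph U T"
    and conn: "connected_graph U T"
    and tail_notin_side: "{y, z} \<in> T \<Longrightarrow> y \<notin> side y z"
    and head_in_side: "{y, z} \<in> T \<Longrightarrow> z \<in> side y z"
    and leave_side: "\<lbrakk>{y, z} \<in> T; {s, t} \<in> T; s \<in> side y z; t \<notin> side y z\<rbrakk> \<Longrightarrow> s = z \<and> t = y"
    and side_nested: "\<lbrakk>{y, z} \<in> T; {z, x} \<in> T; x \<noteq> y\<rbrakk> \<Longrightarrow> side z x \<subseteq> side y z"
begin

lemma edge_in_U: "{y, z} \<in> T \<Longrightarrow> y \<in> U \<and> z \<in> U"
  using simple by (auto simp: simple_graph_def)

lemma edge_neq: "{y, z} \<in> T \<Longrightarrow> y \<noteq> z"
  using simple by (auto simp: simple_graph_def)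

lemma walk_out_of_side:
  assumes "{y, z} \<in> T" "t \<in> side y z" "x \<notin> side y z" "(t, x) \<in> directed_edges T ^^ n"
  shows "\<exists>k<n. (y, x) \<in> directed_edges T ^^ k"
  using assms(2,4)
proof (induction n arbitrary: t)
  case 0
  then show ?case using assms(3) by simp
next
  case (Suc n)
  then obtain t' where t': "(t, t') \<in> directed_edges T" "(t', x) \<in> directed_edges T ^^ n"
    by (blast elim: relpow_Suc_E2)
  show ?case
  proof (cases "t' \<in> side y z")
    case True
    then show ?thesis using Suc.IH[OF True t'(2)] by (auto intro: less_SucI)
  next
    case False
    then have "t' = y" using leave_side[OF assms(1) _ Suc.prems(1)] t'(1)
      by (auto simp: directed_edges_def)
    then show ?thesis using t'(2) by auto
  qed
qed

text \<open>A walk inside \<open>X\<close> from the tail \<open>y\<close> could enter the half tree only by the edge from \<open>y\<close> to \<open>z\<close>,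
  and \<open>z\<close> is not in \<open>X\<close>.\<close>

lemma side_avoids_subgraph:
  assumes X: "finite_connected_subgraph X F U T" and b: "(y, z) \<in> boundary T X"
  shows "X \<inter> side y z = {}"
proof -
  have b': "{y, z} \<in> T" "y \<in> X" "z \<notin> X" using b by (auto simp: boundary_def)
  have F: "F \<subseteq> T" "simple_graph X F" "connected_graph X F"
    using X by (auto simp: finite_connected_subgraph_def)
  have "x \<notin> side y z" if "x \<in> X" for x
  proof -
    have "(y, x) \<in> (directed_edges F)\<^sup>*"
      using F(3) b'(2) that by (auto simp: connected_graph_def)
    then show ?thesis
    proof (induction rule: rtrancl_induct)
      case base
      then show ?case using tail_notin_side[OF b'(1)] .
    next
      case (step s t)
      then have e: "{s, t} \<in> F" by (simp add: directed_edges_def)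
      then have t: "{t, s} \<in> T" "t \<in> X"
        using F by (auto simp: insert_commute simple_graph_def)
      show ?case
      proof
        assume "t \<in> side y z"
        then have "t = z" using leave_side[OF b'(1) t(1)] step.IH by blast
        then show False using t(2) b'(3) by simp
      qed
    qed
  qed
  then show ?thesis by blast
qed

lemma nb_level_edge:
  assumes "(y, z) \<in> nb_level T r (boundary T X)"
  shows "{y, z} \<in> T"
  using assms by (cases r) (auto simp: boundary_def nb_step_def)

lemma nb_level_walk:
  assumes "(y, z) \<in> nb_level T r (boundary T X)"
  shows "\<exists>x\<in>X. (y, x) \<in> directed_edges T ^^ r"
  using assms
proof (induction r arbitrary: y z)
  case 0
  then show ?case by (auto simp: boundary_def)
next
  case (Suc r)
  then obtain p where p: "(p, y) \<in> nb_level T r (boundary T X)" "{p, y} \<in> T"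
    unfolding nb_level_Suc by (auto simp: nb_step_def)
  then obtain x where "x \<in> X" "(p, x) \<in> directed_edges T ^^ r" using Suc.IH by blast
  moreover have "(y, p) \<in> directed_edges T" using p(2)
    by (simp add: directed_edges_def insert_commute)
  ultimately show ?case by (meson relpow_Suc_I2)
qed

text \<open>Non-backtracking walks out of \<open>X\<close> are geodesic. A walk back to \<open>X\<close> has to leave all the nested
  half trees that were entered, which costs one step for each of them.\<close>

lemma nb_level_far:
  assumes X: "finite_connected_subgraph X F U T"
    and "(y, z) \<in> nb_level T r (boundary T X)"
  shows "X \<inter> side y z = {} \<and>
    (\<forall>t\<in>side y z. \<forall>x\<in>X. \<forall>n. (t, x) \<in> directed_edges T ^^ n \<longrightarrow> r < n)"
  using assms(2)
proof (induction r arbitrary: y z)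
  case 0
  then have b: "(y, z) \<in> boundary T X" by simp
  then have e: "{y, z} \<in> T" by (simp add: boundary_def)
  have disj: "X \<inter> side y z = {}" by (rule side_avoids_subgraph[OF X b])
  have "0 < n" if "t \<in> side y z" "x \<in> X" "(t, x) \<in> directed_edges T ^^ n" for t x n
  proof -
    have "x \<notin> side y z" using disj that(2) by blast
    then show ?thesis using that(1,3) by (cases n) auto
  qed
  with disj show ?case by blast
next
  case (Suc r)
  then obtain p where p: "(p, y) \<in> nb_level T r (boundary T X)" "{p, y} \<in> T" "{y, z} \<in> T" "z \<noteq> p"
    unfolding nb_level_Suc by (auto simp: nb_step_def)
  note IH = Suc.IH[OF p(1)]
  have disj: "X \<inter> side y z = {}" using side_nested[OF p(2,3,4)] IH by blast
  have "Suc r < n" if tx: "t \<in> side y z" "x \<in> X" "(t, x) \<in> directed_edges T ^^ n" for t x n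
  proof -
    have "x \<notin> side y z" using disj tx(2) by blast
    then obtain k where "k < n" "(y, x) \<in> directed_edges T ^^ k"
      using walk_out_of_side[OF p(3) tx(1) _ tx(3)] by blast
    moreover have "r < k"
      using IH head_in_side[OF p(2)] tx(2) \<open>(y, x) \<in> directed_edges T ^^ k\<close> by blast
    ultimately show ?thesis by simp
  qed
  with disj show ?case by blast
qed

lemma nb_level_head_far:
  assumes "finite_connected_subgraph X F U T" "(y, z) \<in> nb_level T r (boundary T X)"
    and "x \<in> X" "(z, x) \<in> directed_edges T ^^ n"
  shows "r < n"
  using nb_level_far[OF assms(1,2)] head_in_side[OF nb_level_edge[OF assms(2)]] assms(3,4) by blast

lemma nb_level_tail_far:
  assumes X: "finite_connected_subgraph X F U T" and yz: "(y, z) \<in> nb_level T r (boundary T X)"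
    and x: "x \<in> X" "(y, x) \<in> directed_edges T ^^ n"
  shows "r \<le> n"
proof (cases r)
  case (Suc r')
  then obtain p where "(p, y) \<in> nb_level T r' (boundary T X)"
    using yz unfolding Suc nb_level_Suc by (auto simp: nb_step_def)
  then have "r' < n" using nb_level_head_far[OF X _ x] by blast
  then show ?thesis using Suc by simp
qed simp

lemma nb_level_unique_tail:
  assumes X: "finite_connected_subgraph X F U T"
    and "(y, z) \<in> nb_level T r (boundary T X)" "(y', z) \<in> nb_level T r (boundary T X)"
  shows "y = y'"
proof (rule ccontr)
  assume "y \<noteq> y'"
  then have "((y, z), (z, y')) \<in> nb_step T"
    using nb_level_edge[OF assms(2)] nb_level_edge[OF assms(3)]
    by (auto simp: nb_step_def insert_commute)
  then have "(z, y') \<in> nb_level T (Suc r) (boundary T X)"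
    using assms(2) unfolding nb_level_Suc by blast
  moreover obtain x where "x \<in> X" "(y', x) \<in> directed_edges T ^^ r"
    using nb_level_walk[OF assms(3)] by blast
  ultimately have "Suc r < r" by (rule nb_level_head_far[OF X])
  then show False by simp
qed

lemma inj_on_undirect:
  assumes X: "finite_connected_subgraph X F U T"
  shows "inj_on undirect (nb_level T r (boundary T X))"
proof (rule inj_onI)
  fix a b assume ab: "a \<in> nb_level T r (boundary T X)" "b \<in> nb_level T r (boundary T X)"
    "undirect a = undirect b"
  obtain y z where a: "a = (y, z)" by (cases a)
  obtain y' z' where b: "b = (y', z')" by (cases b)
  show "a = b"
  proof (rule ccontr)
    assume "a \<noteq> b"
    then have "b = (z, y)" using ab(3) a b by (auto simp: doubleton_eq_iff)
    with ab(2) have "(z, y) \<in> nb_level T r (boundary T X)" by simp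
    moreover obtain x where "x \<in> X" "(y, x) \<in> directed_edges T ^^ r"
      using nb_level_walk[of y z r X] ab(1) a by blast
    ultimately have "r < r" by (rule nb_level_head_far[OF X])
    then show False by simp
  qed
qed

lemma graph_dist_walk:
  assumes "x \<in> U" "v \<in> U"
  shows "(x, v) \<in> directed_edges T ^^ graph_dist T x v"
proof -
  have "(x, v) \<in> (directed_edges T)\<^sup>*" using conn assms by (auto simp: connected_graph_def)
  then obtain n where "(x, v) \<in> directed_edges T ^^ n" by (auto simp: rtrancl_power)
  then show ?thesis unfolding graph_dist_def by (rule LeastI)
qed

lemma graph_dist_le: "(x, v) \<in> directed_edges T ^^ n \<Longrightarrow> graph_dist T x v \<le> n"
  unfolding graph_dist_def by (rule Least_le)

lemma edge_tube_iff:
  assumes "finite X" "X \<noteq> {}"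
  shows "{y, z} \<in> edge_tube T r X \<longleftrightarrow> {y, z} \<in> T \<and>
    (\<exists>v\<in>X. min (graph_dist T y v) (graph_dist T z v) = r) \<and>
    (\<forall>v\<in>X. r \<le> min (graph_dist T y v) (graph_dist T z v))"
proof -
  define m where "m a b = (MIN v\<in>X. min (graph_dist T a v) (graph_dist T b v))" for a b
  have "m a b = m b a" for a b by (simp add: m_def min.commute)
  then have "{y, z} \<in> edge_tube T r X \<longleftrightarrow> {y, z} \<in> T \<and> m y z = r"
    unfolding edge_tube_def m_def[symmetric] by (auto simp: doubleton_eq_iff)
  moreover have "m y z = r \<longleftrightarrow>
    (\<exists>v\<in>X. min (graph_dist T y v) (graph_dist T z v) = r) \<and>
    (\<forall>v\<in>X. r \<le> min (graph_dist T y v) (graph_dist T z v))"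
    unfolding m_def using assms by (subst Min_eq_iff) auto
  ultimately show ?thesis by blast
qed

lemma nb_level_in_tube:
  assumes X: "finite_connected_subgraph X F U T"
    and yz: "(y, z) \<in> nb_level T r (boundary T X)"
  shows "{y, z} \<in> edge_tube T r X"
proof -
  have X': "finite X" "X \<noteq> {}" "X \<subseteq> U"
    using X by (auto simp: finite_connected_subgraph_def connected_graph_def)
  have e: "{y, z} \<in> T" using nb_level_edge[OF yz] .
  then have U: "y \<in> U" "z \<in> U" using edge_in_U by auto
  have ge: "r \<le> min (graph_dist T y v) (graph_dist T z v)" if "v \<in> X" for v
  proof -
    have "v \<in> U" using that X' by blast
    show ?thesis
      using nb_level_tail_far[OF X yz that graph_dist_walk[OF U(1) \<open>v \<in> U\<close>]]
        nb_level_head_far[OF X yz that graph_dist_walk[OF U(2) \<open>v \<in> U\<close>]] by simp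
  qed
  obtain v where v: "v \<in> X" "(y, v) \<in> directed_edges T ^^ r" using nb_level_walk[OF yz] by blast
  have "min (graph_dist T y v) (graph_dist T z v) = r"
    using ge[OF v(1)] graph_dist_le[OF v(2)] by simp
  with ge v(1) e show ?thesis unfolding edge_tube_iff[OF X'(1,2)] by blast
qed

text \<open>Conversely, a geodesic from \<open>X\<close>, read outwards, is a non-backtracking walk.\<close>

lemma nb_level_reaches:
  assumes "v \<in> X" "(x, v) \<in> directed_edges T ^^ Suc r"
    and "\<And>v' n. v' \<in> X \<Longrightarrow> (x, v') \<in> directed_edges T ^^ n \<Longrightarrow> r < n"
  shows "\<exists>p. (p, x) \<in> nb_level T r (boundary T X)"
  using assms(2,3)
proof (induction r arbitrary: x)
  case 0
  then have "{x, v} \<in> T" by (auto simp: directed_edges_def)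
  moreover have "x \<notin> X" using "0.prems"(2)[of x 0] by auto
  ultimately show ?case using assms(1) by (auto simp: boundary_def insert_commute)
next
  case (Suc r)
  obtain p where p: "(x, p) \<in> directed_edges T" "(p, v) \<in> directed_edges T ^^ Suc r"
    using Suc.prems(1) by (blast elim: relpow_Suc_E2)
  have "r < n" if "v' \<in> X" "(p, v') \<in> directed_edges T ^^ n" for v' n
    using Suc.prems(2)[OF that(1) relpow_Suc_I2[OF p(1) that(2)]] by simp
  then obtain p' where p': "(p', p) \<in> nb_level T r (boundary T X)"
    using Suc.IH[OF p(2)] by blast
  \<comment> \<open>The vertex \<open>p'\<close> is nearer to \<open>X\<close> than \<open>x\<close> is.\<close>
  have "x \<noteq> p'"
  proof
    assume "x = p'"
    then obtain v' where "v' \<in> X" "(x, v') \<in> directed_edges T ^^ r"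
      using nb_level_walk[OF p'] by blast
    then show False using Suc.prems(2) by fastforce
  qed
  then have "((p', p), (p, x)) \<in> nb_step T"
    using p(1) nb_level_edge[OF p'] by (auto simp: nb_step_def directed_edges_def insert_commute)
  then show ?case using p' unfolding nb_level_Suc by blast
qed

text \<open>The radius has to be positive: the tube of radius \<open>0\<close> also contains the edges inside \<open>X\<close>.\<close>

lemma edge_tube_Suc:
  assumes X: "finite_connected_subgraph X F U T"
  shows "edge_tube T (Suc r) X = undirect ` nb_level T (Suc r) (boundary T X)"
proof
  show "undirect ` nb_level T (Suc r) (boundary T X) \<subseteq> edge_tube T (Suc r) X"
  proof (rule image_subsetI)
    fix a assume "a \<in> nb_level T (Suc r) (boundary T X)"
    then show "undirect a \<in> edge_tube T (Suc r) X"
      using nb_level_in_tube[OF X, of "fst a" "snd a"] by simp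
  qed
next
  have X': "finite X" "X \<noteq> {}" "X \<subseteq> U"
    using X by (auto simp: finite_connected_subgraph_def connected_graph_def)
  have key: "\<exists>a \<in> nb_level T (Suc r) (boundary T X). {x, y} = undirect a"
    if e: "{x, y} \<in> T" and v: "v \<in> X" "graph_dist T x v = Suc r"
      and ge: "\<forall>v\<in>X. Suc r \<le> graph_dist T x v \<and> Suc r \<le> graph_dist T y v" for x y v
  proof -
    have U: "x \<in> U" "v \<in> U" using e v X'(3) edge_in_U by auto
    have far: "r < n" if "v' \<in> X" "(t, v') \<in> directed_edges T ^^ n" "t = x \<or> t = y" for v' n t
      using ge that graph_dist_le[OF that(2)] by fastforce
    obtain p where p: "(p, x) \<in> nb_level T r (boundary T X)"
      using nb_level_reaches[OF v(1), of x r] graph_dist_walk[OF U] v(2) far by metis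
    have "y \<noteq> p" using nb_level_walk[OF p] far by blast
    then have "((p, x), (x, y)) \<in> nb_step T"
      using e nb_level_edge[OF p] by (auto simp: nb_step_def)
    then have "(x, y) \<in> nb_level T (Suc r) (boundary T X)"
      using p unfolding nb_level_Suc by blast
    then show ?thesis by force
  qed
  show "edge_tube T (Suc r) X \<subseteq> undirect ` nb_level T (Suc r) (boundary T X)"
  proof
    fix e assume e: "e \<in> edge_tube T (Suc r) X"
    then obtain x y where xy: "e = {x, y}" by (auto simp: edge_tube_def)
    from e obtain v where v: "{x, y} \<in> T" "v \<in> X"
      "min (graph_dist T x v) (graph_dist T y v) = Suc r"
      "\<forall>v\<in>X. Suc r \<le> min (graph_dist T x v) (graph_dist T y v)"
      unfolding xy edge_tube_iff[OF X'(1,2)] by blast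
    from v(3) consider "graph_dist T x v = Suc r" | "graph_dist T y v = Suc r"
      by (auto simp: min_def split: if_splits)
    then have "\<exists>a \<in> nb_level T (Suc r) (boundary T X). {x, y} = undirect a"
    proof cases
      case 1
      then show ?thesis using key[OF v(1,2)] v(4) by auto
    next
      case 2
      have "{y, x} \<in> T" using v(1) by (simp add: insert_commute)
      then show ?thesis using key[OF _ v(2) 2] v(4) by (auto simp: insert_commute)
    qed
    then show "e \<in> undirect ` nb_level T (Suc r) (boundary T X)" unfolding xy by blast
  qed
qed

lemma singleton_subgraph: "v \<in> U \<Longrightarrow> finite_connected_subgraph {v} {} U T"
  by (simp add: finite_connected_subgraph_def simple_graph_def connected_graph_def)

lemma edge_sphere_eq_tube: "edge_sphere T r v = edge_tube T r {v}"
  by (simp add: edge_sphere_def edge_tube_def)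

text \<open>Members of the sphere around \<open>w'\<close> are reached from \<open>w'\<close> by a non-backtracking walk. If its first
  edge is not the one to \<open>w\<close>, prepending the edge from \<open>w\<close> to \<open>w'\<close> gives a walk without
  backtracking, so the distance to \<open>w\<close> is larger than the distance to \<open>w'\<close> and not smaller.\<close>

lemma edge_arc_eq:
  assumes e: "{w', w} \<in> T"
  shows "edge_arc T r (w', w) = undirect ` nb_level T r {(w', w)}"
proof (cases r)
  case (Suc n)
  have U: "w' \<in> U" "w \<in> U" and ne: "w \<noteq> w'" using edge_in_U[OF e] edge_neq[OF e] by auto
  note X' = singleton_subgraph[OF U(1)] and X = singleton_subgraph[OF U(2)]
  have b: "(w', w) \<in> boundary T {w'}" "(w, w') \<in> boundary T {w}"
    using e ne by (auto simp: boundary_def insert_commute)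
  have unique_radius: "m = k" if r: "e \<in> edge_tube T m {w}" "e \<in> edge_tube T k {w}" for e m k
  proof -
    obtain x y where "e = {x, y}" using r(1) by (auto simp: edge_tube_def)
    then show ?thesis using r edge_tube_iff[of "{w}" x y] by auto
  qed
  have "undirect a \<in> edge_tube T n {w}" if a: "a \<in> nb_level T (Suc n) {(w', w)}" for a
  proof -
    obtain c where c: "((w', w), c) \<in> nb_step T" "(c, a) \<in> nb_step T ^^ n"
      using a by (blast elim: relpow_Suc_E2)
    then have "c \<in> boundary T {w}" using edge_neq by (auto simp: nb_step_def boundary_def)
    then have "a \<in> nb_level T n (boundary T {w})" using c(2) by blast
    then show ?thesis using nb_level_in_tube[OF X, of "fst a" "snd a"] by simp
  qed
  moreover have "undirect a \<in> edge_tube T (Suc n) {w'}"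
    if a: "a \<in> nb_level T (Suc n) {(w', w)}" for a
  proof -
    have "a \<in> nb_level T (Suc n) (boundary T {w'})" using a b(1) by blast
    then show ?thesis using nb_level_in_tube[OF X', of "fst a" "snd a"] by simp
  qed
  moreover have "e \<in> undirect ` nb_level T (Suc n) {(w', w)}"
    if e': "e \<in> edge_tube T (Suc n) {w'}" "e \<in> edge_tube T n {w}" for e
  proof -
    obtain a where a: "a \<in> nb_level T (Suc n) (boundary T {w'})" "e = undirect a"
      using e'(1) unfolding edge_tube_Suc[OF X'] by blast
    then obtain c where c: "c \<in> boundary T {w'}" "(c, a) \<in> nb_step T ^^ Suc n" by blast
    then obtain z where z: "c = (w', z)" "{w', z} \<in> T" by (auto simp: boundary_def)
    have "z = w"
    proof (rule ccontr)
      assume "z \<noteq> w"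
      then have "((w, w'), c) \<in> nb_step T"
        using z e by (auto simp: nb_step_def insert_commute)
      then have "((w, w'), a) \<in> nb_step T ^^ Suc (Suc n)"
        using c(2) by (rule relpow_Suc_I2)
      then have "a \<in> nb_level T (Suc (Suc n)) (boundary T {w})" using b(2) by blast
      then have "e \<in> edge_tube T (Suc (Suc n)) {w}"
        using nb_level_in_tube[OF X, of "fst a" "snd a"] a(2) by simp
      from unique_radius[OF e'(2) this] show False by simp
    qed
    then show ?thesis using c z a(2) by blast
  qed
  ultimately show ?thesis unfolding Suc edge_arc.simps edge_sphere_eq_tube by blast
qed simp

text \<open>Each edge of a level has a unique predecessor in the level before, and \<open>\<pi>\<close> maps the successors
  of an edge bijectively to the successors of its image. So summing over a level amounts to
  applying the averaging operator downstairs.\<close>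

lemma sum_nb_level:
  fixes \<pi> :: "'a \<times> 'a \<Rightarrow> 'v \<times> 'v"
  assumes X: "finite_connected_subgraph X F U T"
    and S: "S \<subseteq> boundary T X" "finite S"
    and cover: "\<And>a. a \<in> directed_edges T \<Longrightarrow>
      bij_betw \<pi> (nb_step T `` {a}) (nb_step E `` {\<pi> a})"
    and fin: "\<And>a. finite (nb_step E `` {a})" and q: "q > 0"
  shows "finite (nb_level T r S) \<and>
    (\<Sum>b\<in>nb_level T r S. g (\<pi> b)) = real q ^ r * (\<Sum>a\<in>S. (nb_avg E q ^^ r) g (\<pi> a))"
proof (induction r arbitrary: g)
  case 0
  then show ?case using S by simp
next
  case (Suc r)
  define L where "L = nb_level T r S"
  have finL: "finite L" using Suc by (simp add: L_def)
  have Lb: "L \<subseteq> nb_level T r (boundary T X)" unfolding L_def using S by blast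
  have dir: "a \<in> directed_edges T" if "a \<in> L" for a
  proof -
    have "(fst a, snd a) \<in> nb_level T r (boundary T X)" using that Lb by auto
    then have "{fst a, snd a} \<in> T" by (rule nb_level_edge)
    then show ?thesis by (simp add: directed_edges_def split_beta)
  qed
  have finB: "finite (nb_step T `` {a})" if "a \<in> L" for a
    using bij_betw_finite[OF cover[OF dir[OF that]]] fin by simp
  have disj: "nb_step T `` {a} \<inter> nb_step T `` {b} = {}" if ab: "a \<in> L" "b \<in> L" "a \<noteq> b" for a b
  proof (rule ccontr)
    assume "nb_step T `` {a} \<inter> nb_step T `` {b} \<noteq> {}"
    then have "snd a = snd b" by (auto simp: nb_step_def)
    moreover have "fst a = fst b"
    proof (rule nb_level_unique_tail[OF X, of _ "snd a" r])
      show "(fst a, snd a) \<in> nb_level T r (boundary T X)" using ab(1) Lb by auto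
      show "(fst b, snd a) \<in> nb_level T r (boundary T X)"
        unfolding \<open>snd a = snd b\<close> using ab(2) Lb by auto
    qed
    ultimately show False using ab(3) by (simp add: prod_eq_iff)
  qed
  have L': "nb_level T (Suc r) S = (\<Union>a\<in>L. nb_step T `` {a})"
    unfolding L_def by (rule nb_level_Suc)
  have "(\<Sum>b\<in>nb_level T (Suc r) S. g (\<pi> b)) = (\<Sum>a\<in>L. \<Sum>b\<in>nb_step T `` {a}. g (\<pi> b))"
    unfolding L' using finL finB disj by (intro sum.UNION_disjoint) auto
  also have "\<dots> = (\<Sum>a\<in>L. real q * nb_avg E q g (\<pi> a))"
  proof (rule sum.cong[OF refl])
    fix a assume "a \<in> L"
    have "(\<Sum>b\<in>nb_step T `` {a}. g (\<pi> b)) = (\<Sum>b\<in>nb_step E `` {\<pi> a}. g b)"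
      by (rule sum.reindex_bij_betw[OF cover[OF dir[OF \<open>a \<in> L\<close>]]])
    then show "(\<Sum>b\<in>nb_step T `` {a}. g (\<pi> b)) = real q * nb_avg E q g (\<pi> a)"
      using q by (simp add: nb_avg_def)
  qed
  also have "\<dots> = real q * (\<Sum>a\<in>L. nb_avg E q g (\<pi> a))" by (simp add: sum_distrib_left)
  also have "\<dots> = real q * (real q ^ r * (\<Sum>a\<in>S. (nb_avg E q ^^ r) (nb_avg E q g) (\<pi> a)))"
    using Suc.IH[of "nb_avg E q g"] by (simp add: L_def)
  also have "\<dots> = real q ^ Suc r * (\<Sum>a\<in>S. (nb_avg E q ^^ Suc r) g (\<pi> a))"
    by (simp add: funpow_swap1)
  finally show ?case unfolding L' using finL finB by auto
qed

end


section \<open>The universal cover as a tree of half trees\<close>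

lemma cover_edgeE:
  assumes "{y, z} \<in> cover_edges V E v0"
  obtains (down) a where "z = y @ [a]" "y \<in> cover_verts V E v0" "z \<in> cover_verts V E v0"
  | (up) a where "y = z @ [a]" "y \<in> cover_verts V E v0" "z \<in> cover_verts V E v0"
proof -
  from assms obtain p w where "{y, z} = {p, p @ [w]}" "p \<in> cover_verts V E v0"
    "p @ [w] \<in> cover_verts V E v0"
    unfolding cover_edges_def by blast
  then show ?thesis using that by (auto simp: doubleton_eq_iff)
qed

lemma cover_edge_project:
  assumes "{y, z} \<in> cover_edges V E v0"
  shows "{last y, last z} \<in> E"
proof -
  have *: "{last p, a} \<in> E" if "p \<in> cover_verts V E v0" "p @ [a] \<in> cover_verts V E v0" for p a
    using that by (auto simp: cover_verts_def successively_append_iff)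
  from assms show ?thesis
  proof (cases rule: cover_edgeE)
    case (down a)
    then show ?thesis using * by simp
  next
    case (up a)
    then show ?thesis using *[of z a] by (simp add: insert_commute)
  qed
qed

lemma cover_verts_no_backtrack:
  assumes "t @ [d, a] \<in> cover_verts V E v0" "t \<noteq> []"
  shows "a \<noteq> last t"
proof -
  have l: "length t \<ge> 1" using assms(2) by (cases t) auto
  have "(t @ [d, a]) ! (length t - 1) \<noteq> (t @ [d, a]) ! (length t - 1 + 2)"
    using assms(1) l unfolding cover_verts_def by (simp del: One_nat_def)
  moreover have "(t @ [d, a]) ! (length t - 1) = last t"
    using assms(2) l by (simp add: nth_append last_conv_nth)
  moreover have "(t @ [d, a]) ! (length t - 1 + 2) = a"
  proof -
    have "length t - 1 + 2 = length t + 1" using l by simp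
    then show ?thesis by (simp add: nth_append)
  qed
  ultimately show ?thesis by metis
qed

text \<open>The only neighbours of a path that could end in the same vertex are its truncation and an
  extension, and such an extension would backtrack.\<close>

lemma cover_locally_injective:
  assumes "{p, s} \<in> cover_edges V E v0" "{p, t} \<in> cover_edges V E v0" "last s = last t"
  shows "s = t"
proof -
  have clash: False
    if "s = p @ [a]" "p = t @ [d]" "s \<in> cover_verts V E v0" "t \<in> cover_verts V E v0"
      "last s = last t" for s t a d
  proof -
    have "t @ [d, a] \<in> cover_verts V E v0" "t \<noteq> []"
      using that by (auto simp: cover_verts_def)
    then have "a \<noteq> last t" by (rule cover_verts_no_backtrack)
    then show False using that by simp
  qed
  from assms(1) show ?thesis
  proof (cases rule: cover_edgeE)
    case s: (down a)
    from assms(2) show ?thesis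
    proof (cases rule: cover_edgeE)
      case (down b)
      then show ?thesis using s assms(3) by simp
    next
      case (up b)
      then show ?thesis using s clash[of s a t b] assms(3) by simp
    qed
  next
    case s: (up a)
    from assms(2) show ?thesis
    proof (cases rule: cover_edgeE)
      case (down b)
      then show ?thesis using s clash[of t b s a] assms(3) by simp
    next
      case (up b)
      then show ?thesis using s by simp
    qed
  qed
qed

lemma cover_verts_butlast:
  assumes "p @ [w] \<in> cover_verts V E v0" "p \<noteq> []"
  shows "p \<in> cover_verts V E v0"
proof -
  have "p ! i \<noteq> p ! (i + 2)" if "i + 2 < length p" for i
  proof -
    have "(p @ [w]) ! i \<noteq> (p @ [w]) ! (i + 2)"
      using assms(1) that unfolding cover_verts_def by auto
    then show ?thesis using that by (simp add: nth_append)
  qed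
  then show ?thesis using assms by (auto simp: cover_verts_def successively_append_iff)
qed

lemma cover_walk_to_root:
  "p \<in> cover_verts V E v0 \<Longrightarrow> (p, [v0]) \<in> (directed_edges (cover_edges V E v0))\<^sup>*"
proof (induction p rule: rev_induct)
  case Nil
  then show ?case by (simp add: cover_verts_def)
next
  case (snoc w p)
  show ?case
  proof (cases "p = []")
    case True
    then show ?thesis using snoc.prems by (simp add: cover_verts_def)
  next
    case False
    have p: "p \<in> cover_verts V E v0" by (rule cover_verts_butlast[OF snoc.prems False])
    then have "{p, p @ [w]} \<in> cover_edges V E v0"
      using snoc.prems unfolding cover_edges_def by blast
    then have "(p @ [w], p) \<in> directed_edges (cover_edges V E v0)"
      by (simp add: directed_edges_def insert_commute)
    then show ?thesis using snoc.IH[OF p] by (rule converse_rtrancl_into_rtrancl)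
  qed
qed

lemma connected_cover:
  assumes "v0 \<in> V"
  shows "connected_graph (cover_verts V E v0) (cover_edges V E v0)"
proof -
  have "[v0] \<in> cover_verts V E v0" using assms by (auto simp: cover_verts_def)
  moreover have "(p, s) \<in> (directed_edges (cover_edges V E v0))\<^sup>*"
    if "p \<in> cover_verts V E v0" "s \<in> cover_verts V E v0" for p s
    using cover_walk_to_root[OF that(1)] cover_walk_to_root[OF that(2)]
      sym_rtrancl[OF sym_directed_edges] by (meson rtrancl_trans symD)
  ultimately show ?thesis unfolding connected_graph_def by blast
qed

text \<open>The edges join a path to a one-step extension. The half tree beyond the longer path consists of
  the paths extending it, and the half tree beyond the shorter one is the complement.\<close>

definition cover_side :: "'v list \<Rightarrow> 'v list \<Rightarrow> 'v list set" where
  "cover_side y z = (if prefix y z then {s. prefix z s} else {s. \<not> prefix y s})"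

lemma cover_half_tree_graph:
  assumes "v0 \<in> V"
  shows "half_tree_graph (cover_verts V E v0) (cover_edges V E v0) cover_side"
proof
  show "simple_graph (cover_verts V E v0) (cover_edges V E v0)"
    by (auto simp: simple_graph_def cover_edges_def)
  show "connected_graph (cover_verts V E v0) (cover_edges V E v0)"
    using assms by (rule connected_cover)
next
  fix y z :: "'a list" assume e: "{y, z} \<in> cover_edges V E v0"
  then show "y \<notin> cover_side y z" "z \<in> cover_side y z"
    by (cases rule: cover_edgeE; auto simp: cover_side_def dest: prefix_length_le)+
next
  fix y z s t :: "'a list"
  assume e: "{y, z} \<in> cover_edges V E v0" "{s, t} \<in> cover_edges V E v0"
    and st: "s \<in> cover_side y z" "t \<notin> cover_side y z"
  from e(1) show "s = z \<and> t = y"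
  proof (cases rule: cover_edgeE)
    case (down a)
    then have "prefix z s" "\<not> prefix z t" using st by (auto simp: cover_side_def)
    with e(2) down(1) show ?thesis by (cases rule: cover_edgeE) auto
  next
    case (up a)
    then have "\<not> prefix y s" "prefix y t"
      using st by (auto simp: cover_side_def split: if_splits dest: prefix_length_le)
    with e(2) up(1) show ?thesis by (cases rule: cover_edgeE) auto
  qed
next
  fix y z x :: "'a list"
  have two: "prefix (l @ [a, b]) s \<Longrightarrow> prefix (l @ [a]) s" for l s :: "'a list" and a b
    using append_prefixD[of "l @ [a]" "[b]" s] by simp
  assume "{y, z} \<in> cover_edges V E v0" "{z, x} \<in> cover_edges V E v0" "x \<noteq> y"
  then show "cover_side z x \<subseteq> cover_side y z"
    by (elim cover_edgeE)
      (auto simp: cover_side_def dest: prefix_length_le prefix_same_cases two)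
qed

text \<open>The projection is a local isomorphism, so it respects the condition of not going back.\<close>

lemma cover_bij_nb_step:
  assumes sg: "simple_graph V E" and a: "a \<in> directed_edges (cover_edges V E v0)"
  shows "bij_betw (map_prod last last) (nb_step (cover_edges V E v0) `` {a})
    (nb_step E `` {map_prod last last a})"
proof -
  define T where "T = cover_edges V E v0"
  obtain y z where yz: "a = (y, z)" by (cases a)
  have e: "{y, z} \<in> T" "{z, y} \<in> T"
    using a yz by (auto simp: directed_edges_def T_def insert_commute)
  have succ: "nb_step T `` {a} = {(z, x) | x. {z, x} \<in> T \<and> x \<noteq> y}"
    using e yz by (auto simp: nb_step_def)
  have succ': "nb_step E `` {map_prod last last a}
      = {(last z, w) | w. {last z, w} \<in> E \<and> w \<noteq> last y}"
    using cover_edge_project[OF e(1)[unfolded T_def]] yz by (auto simp: nb_step_def)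
  have "inj_on (map_prod last last) (nb_step T `` {a})"
    unfolding succ by (auto simp: inj_on_def T_def intro: cover_locally_injective)
  moreover have "map_prod last last ` (nb_step T `` {a}) = nb_step E `` {map_prod last last a}"
  proof
    show "map_prod last last ` (nb_step T `` {a}) \<subseteq> nb_step E `` {map_prod last last a}"
    proof
      fix b assume "b \<in> map_prod last last ` (nb_step T `` {a})"
      then obtain x where x: "b = (last z, last x)" "{z, x} \<in> T" "x \<noteq> y"
        unfolding succ by auto
      then have "last x \<noteq> last y"
        using cover_locally_injective[of z x V E v0 y] e(2) unfolding T_def by blast
      then show "b \<in> nb_step E `` {map_prod last last a}"
        unfolding succ' using x cover_edge_project[of z x V E v0] by (auto simp: T_def)
    qed
    show "nb_step E `` {map_prod last last a} \<subseteq> map_prod last last ` (nb_step T `` {a})"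
    proof
      fix b assume "b \<in> nb_step E `` {map_prod last last a}"
      then obtain w where w: "b = (last z, w)" "{last z, w} \<in> E" "w \<noteq> last y"
        unfolding succ' by auto
      have "z \<in> cover_verts V E v0" using e(1) unfolding T_def by (auto elim: cover_edgeE)
      then obtain x where "last x = w" "{z, x} \<in> T"
        using cover_step[OF _ sg w(2)] unfolding T_def by blast
      then have "b = map_prod last last (z, x)" "(z, x) \<in> nb_step T `` {a}"
        using w unfolding succ by auto
      then show "b \<in> map_prod last last ` (nb_step T `` {a})" by blast
    qed
  qed
  ultimately show ?thesis by (simp add: bij_betw_def T_def)
qed


section \<open>Means over levels of the cover\<close>

context finite_regular_graph
begin

lemma sum_directed_edges:
  "(\<Sum>a\<in>directed_edges E. h (undirect a)) = 2 * (\<Sum>e\<in>E. h e :: real)"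
proof -
  have "(\<Sum>a\<in>directed_edges E. h (undirect a))
      = (\<Sum>e\<in>E. \<Sum>a | a \<in> directed_edges E \<and> undirect a = e. h (undirect a))"
    by (rule sum.group[symmetric, OF finite_directed finite_E]) (auto simp: directed_edges_def)
  also have "\<dots> = (\<Sum>e\<in>E. 2 * h e)"
  proof (rule sum.cong[OF refl])
    fix e assume e: "e \<in> E"
    then obtain u w where uw: "e = {u, w}" "u \<noteq> w"
      using simple by (auto simp: simple_graph_def card_2_iff)
    then have "{a. a \<in> directed_edges E \<and> undirect a = e} = {(u, w), (w, u)}"
      using e by (auto simp: directed_edges_def doubleton_eq_iff insert_commute)
    then show "(\<Sum>a | a \<in> directed_edges E \<and> undirect a = e. h (undirect a)) = 2 * h e"
      using uw by (simp add: insert_commute)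
  qed
  finally show ?thesis by (simp add: sum_distrib_left)
qed

definition centred :: "('v set \<Rightarrow> real) \<Rightarrow> 'v \<times> 'v \<Rightarrow> real" where
  "centred f a = f (undirect a) - edge_mean f E"

lemma sum_centred: "(\<Sum>e\<in>E. f e - edge_mean f E) = 0"
  using finite_E by (cases "E = {}") (auto simp: sum_subtractf edge_mean_def)

lemma even_balanced_centred: "even_balanced V E (centred f)"
proof (rule even_balanced_symmetric)
  show "centred f (u, w) = centred f (w, u)" for u w
    by (simp add: centred_def insert_commute)
  have "(\<Sum>v\<in>V. out_sum E (centred f) v) = 2 * (\<Sum>e\<in>E. f e - edge_mean f E)"
    unfolding out_sum_def sum_nbrs_directed
    using sum_directed_edges[of "\<lambda>e. f e - edge_mean f E"] by (simp add: centred_def)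
  then show "(\<Sum>v\<in>V. out_sum E (centred f) v) = 0" by (simp add: sum_centred)
qed

text \<open>Each edge is counted in both directions, and centring does not increase the sum of squares. The
  exact constant \<open>sqrt 2\<close> is rounded up.\<close>

lemma energy_centred_le: "sqrt (energy V E (centred f)) \<le> 2 * L2_set f E"
proof -
  define m where "m = edge_mean f E"
  have "energy V E (centred f) = 2 * (\<Sum>e\<in>E. (f e - m)\<^sup>2)"
    unfolding energy_def sum_nbrs_directed[of "\<lambda>a. (centred f a)\<^sup>2"]
    using sum_directed_edges[of "\<lambda>e. (f e - m)\<^sup>2"] by (simp add: centred_def m_def)
  also have "(\<Sum>e\<in>E. (f e - m)\<^sup>2) = (\<Sum>e\<in>E. (f e)\<^sup>2) - m * (\<Sum>e\<in>E. f e - m) - m * (\<Sum>e\<in>E. f e)"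
    by (simp add: sum_distrib_left sum_subtractf[symmetric] power2_eq_square algebra_simps)
  also have "\<dots> = (\<Sum>e\<in>E. (f e)\<^sup>2) - (\<Sum>e\<in>E. f e)\<^sup>2 / real (card E)"
    using sum_centred[of f] by (simp add: m_def edge_mean_def power2_eq_square)
  also have "\<dots> \<le> (\<Sum>e\<in>E. (f e)\<^sup>2)" by simp
  also have "2 * (\<Sum>e\<in>E. (f e)\<^sup>2) \<le> 4 * (\<Sum>e\<in>E. (f e)\<^sup>2)" by (simp add: sum_nonneg)
  finally have "sqrt (energy V E (centred f)) \<le> sqrt (4 * (\<Sum>e\<in>E. (f e)\<^sup>2))" by simp
  then show ?thesis by (simp add: L2_set_def real_sqrt_mult)
qed

text \<open>All directed edges in \<open>S\<close> have the same number \<open>q ^ r\<close> of descendants in the level, so the mean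
  over the level is the mean over \<open>S\<close> of the \<open>r\<close>-fold average at the projected edges.\<close>

lemma cover_level_mean:
  fixes f :: "'v set \<Rightarrow> real"
  assumes v0: "v0 \<in> V"
    and X: "finite_connected_subgraph X F (cover_verts V E v0) (cover_edges V E v0)"
    and S: "S \<subseteq> boundary (cover_edges V E v0) X" "finite S" "S \<noteq> {}"
    and bound: "\<And>a. a \<in> directed_edges E \<Longrightarrow> \<bar>(nb_avg E q ^^ r) (centred f) a\<bar> \<le> B"
  shows "\<bar>edge_mean (lift_fun f) (undirect ` nb_level (cover_edges V E v0) r S) - edge_mean f E\<bar> \<le> B"
proof -
  define T where "T = cover_edges V E v0"
  define \<pi> :: "'v list \<times> 'v list \<Rightarrow> 'v \<times> 'v" where "\<pi> = map_prod last last"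
  define L where "L = nb_level T r S"
  interpret tree: half_tree_graph "cover_verts V E v0" T cover_side
    unfolding T_def by (rule cover_half_tree_graph[OF v0])
  have fin: "finite (nb_step E `` {a})" for a
    by (rule finite_subset[OF _ finite_directed]) (auto simp: nb_step_def directed_edges_def)
  have lift_step: "bij_betw \<pi> (nb_step T `` {a}) (nb_step E `` {\<pi> a})"
    if "a \<in> directed_edges T" for a
    using cover_bij_nb_step[OF simple] that unfolding T_def \<pi>_def by blast
  have "q > 0" using q_ge2 by simp
  note level_sum = tree.sum_nb_level[OF X[folded T_def] S(1)[folded T_def] S(2) lift_step fin
      \<open>q > 0\<close>, where r = r, folded L_def]
  have finL: "finite L" using level_sum by blast
  have sum: "(\<Sum>b\<in>L. g (\<pi> b)) = real q ^ r * (\<Sum>a\<in>S. (nb_avg E q ^^ r) g (\<pi> a))" for g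
    using level_sum by blast
  have proj: "\<pi> a \<in> directed_edges E" if "a \<in> S" for a
    using that S(1) cover_edge_project
    by (fastforce simp: \<pi>_def boundary_def directed_edges_def)
  \<comment> \<open>The level is counted by summing the constant function \<open>1\<close>.\<close>
  have "real (card L) = real q ^ r * (\<Sum>a\<in>S. 1)"
    using sum[of "\<lambda>_. 1"] by (simp add: nb_avg_funpow_const proj)
  then have card: "real (card L) = real q ^ r * real (card S)" by simp
  then have card0: "real (card L) > 0" using S q_ge2 by (simp add: card_gt_0_iff)
  have "L \<subseteq> nb_level T r (boundary T X)" unfolding L_def using S(1) T_def by blast
  then have inj: "inj_on undirect L"
    using tree.inj_on_undirect[OF X[folded T_def]] inj_on_subset by blast
  have "edge_mean (lift_fun f) (undirect ` L) - edge_mean f E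
      = (\<Sum>b\<in>L. f (undirect (\<pi> b))) / real (card L) - edge_mean f E"
    by (simp add: edge_mean_def sum.reindex[OF inj] card_image[OF inj] lift_fun_def \<pi>_def)
  also have "\<dots> = (\<Sum>b\<in>L. centred f (\<pi> b)) / real (card L)"
    using card0 by (simp add: centred_def sum_subtractf field_simps)
  also have "\<dots> = (\<Sum>a\<in>S. (nb_avg E q ^^ r) (centred f) (\<pi> a)) / real (card S)"
    unfolding sum card using q_ge2 by simp
  finally have "\<bar>edge_mean (lift_fun f) (undirect ` L) - edge_mean f E\<bar>
      = \<bar>\<Sum>a\<in>S. (nb_avg E q ^^ r) (centred f) (\<pi> a)\<bar> / real (card S)" by simp
  also have "\<dots> \<le> (real (card S) * B) / real (card S)"
    using bound proj
    by (intro divide_right_mono order.trans[OF sum_abs] sum_bounded_above) auto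
  also have "\<dots> = B" using S by simp
  finally show ?thesis by (simp add: L_def T_def)
qed

text \<open>Tubes of positive radius would be empty, with mean zero by convention, if \<open>X\<close> had no boundary. But
  a longest path in \<open>X\<close> can be extended, since the degree is larger than one.\<close>

lemma cover_boundary_finite_nonempty:
  assumes X: "finite X" "X \<noteq> {}" "X \<subseteq> cover_verts V E v0"
  shows "finite (boundary (cover_edges V E v0) X)" "boundary (cover_edges V E v0) X \<noteq> {}"
proof -
  define T where "T = cover_edges V E v0"
  have "finite (nbrs T p)" for p
  proof (rule inj_on_finite[OF _ _ finite_nbrs])
    show "inj_on last (nbrs T p)"
    proof (rule inj_onI)
      fix s t assume "s \<in> nbrs T p" "t \<in> nbrs T p" "last s = last t"
      then show "s = t"
        using cover_locally_injective[of p s V E v0 t] by (simp add: nbrs_def T_def)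
    qed
    show "last ` nbrs T p \<subseteq> nbrs E (last p)"
    proof (rule image_subsetI)
      fix s assume "s \<in> nbrs T p"
      then show "last s \<in> nbrs E (last p)"
        using cover_edge_project[of p s V E v0] by (simp add: nbrs_def T_def)
    qed
  qed
  then have "finite (Sigma X (nbrs T))" using X(1) by blast
  then show "finite (boundary (cover_edges V E v0) X)"
    by (rule rev_finite_subset) (auto simp: boundary_def nbrs_def T_def)
  obtain p where p: "p \<in> X" "\<And>s. s \<in> X \<Longrightarrow> length s \<le> length p"
    using Max_in[of "length ` X"] Max_ge[of "length ` X"] X(1,2) by fastforce
  have pV: "p \<in> cover_verts V E v0" using p X(3) by blast
  then have "last p \<in> V" by (auto simp: cover_verts_def)
  then have "\<not> nbrs E (last p) \<subseteq> {last (butlast p)}"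
    using card_nbrs[of "last p"] card_mono[of "{last (butlast p)}" "nbrs E (last p)"] q_ge2 by auto
  then obtain w where w: "{last p, w} \<in> E" "w \<noteq> last (butlast p)" by (auto simp: nbrs_def)
  obtain s where s: "last s = w" "{p, s} \<in> T"
    using cover_step[OF pV simple w(1)] unfolding T_def by blast
  from s(2) have "s \<notin> X" unfolding T_def
  proof (cases rule: cover_edgeE)
    case (down a)
    then show ?thesis using p(2)[of s] by auto
  next
    case (up a)
    then show ?thesis using s(1) w(2) by simp
  qed
  then show "boundary (cover_edges V E v0) X \<noteq> {}"
    using p(1) s(2) unfolding boundary_def T_def by blast
qed

end


section \<open>Convergence of the means over arcs and tubes\<close>

lemma abs_edge_mean_le:
  assumes "\<And>e. e \<in> A \<Longrightarrow> \<bar>f e\<bar> \<le> B" "B \<ge> 0"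
  shows "\<bar>edge_mean f A\<bar> \<le> B"
proof (cases "card A = 0")
  case False
  have "\<bar>\<Sum>e\<in>A. f e\<bar> \<le> real (card A) * B"
    using assms(1) by (intro order.trans[OF sum_abs] sum_bounded_above)
  then show ?thesis using False by (simp add: edge_mean_def field_simps)
qed (simp add: edge_mean_def assms(2))

lemma card_nbrs_eq_degree:
  assumes "simple_graph V E"
  shows "card (nbrs E v) = vertex_degree E v"
proof -
  have "(\<lambda>w. {v, w}) ` nbrs E v = {e \<in> E. v \<in> e}"
  proof
    show "{e \<in> E. v \<in> e} \<subseteq> (\<lambda>w. {v, w}) ` nbrs E v"
    proof
      fix e assume e: "e \<in> {e \<in> E. v \<in> e}"
      then obtain a b where "e = {a, b}" using assms by (auto simp: simple_graph_def card_2_iff)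
      with e have "e = {v, if v = a then b else a}" by auto
      then show "e \<in> (\<lambda>w. {v, w}) ` nbrs E v" using e unfolding nbrs_def by blast
    qed
  qed (auto simp: nbrs_def)
  moreover have "inj_on (\<lambda>w. {v, w}) (nbrs E v)"
    by (auto simp: inj_on_def doubleton_eq_iff)
  ultimately show ?thesis unfolding vertex_degree_def by (metis card_image)
qed

lemma edge_degree_eq:
  assumes "finite E" "simple_graph V E" and e: "{u, w} \<in> E"
  shows "edge_degree E {u, w} + 2 = vertex_degree E u + vertex_degree E w"
proof -
  define A where "A v = {e \<in> E. v \<in> e}" for v
  have fin: "finite (A v)" for v using assms(1) by (simp add: A_def)
  have ne: "u \<noteq> w" using assms(2) e by (auto simp: simple_graph_def)
  have "e' = {u, w}" if "e' \<in> E" "u \<in> e'" "w \<in> e'" for e'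
  proof -
    have "card e' = 2" using assms(2) that(1) by (auto simp: simple_graph_def)
    then show ?thesis using that ne by (auto simp: card_2_iff)
  qed
  then have disj: "(A u - {{u, w}}) \<inter> (A w - {{u, w}}) = {}" by (auto simp: A_def)
  have "{e' \<in> E. e' \<noteq> {u, w} \<and> e' \<inter> {u, w} \<noteq> {}} = (A u - {{u, w}}) \<union> (A w - {{u, w}})"
    by (auto simp: A_def)
  then have "edge_degree E {u, w} = card (A u - {{u, w}}) + card (A w - {{u, w}})"
    unfolding edge_degree_def using card_Un_disjoint[OF _ _ disj] fin by simp
  moreover have "card (A u - {{u, w}}) + 1 = card (A u)" "card (A w - {{u, w}}) + 1 = card (A w)"
    using card_Suc_Diff1[OF fin, of "{u, w}" u] card_Suc_Diff1[OF fin, of "{u, w}" w] e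
    by (auto simp: A_def)
  ultimately show ?thesis unfolding vertex_degree_def A_def[symmetric] by linarith
qed

theorem corollary5:
  fixes V :: "'v set" and E :: "'v set set" and q :: nat
  assumes "finite V"
    and "simple_graph V E"
    and "connected_graph V E"
    and "regular_graph V E"
    and "\<forall>e\<in>E. edge_degree E e = 2 * q"
    and "2 * q \<ge> 4"
  shows "\<exists>C>0. \<forall>f :: 'v set \<Rightarrow> real.
    \<exists>\<beta> \<in> {1 / real q} \<union> {real q powr (- 1 / 2)..<1}.
      \<forall>v0\<in>V.
        (\<forall>a\<in>directed_edges E. \<forall>b\<in>lifts V E v0 a. \<forall>r.
           \<bar>arc_mean V E v0 r b f - edge_mean f E\<bar> \<le> C * L2_set f E * \<beta> ^ r) \<and>
        (\<forall>X F. \<forall>r. finite_connected_subgraph X F (cover_verts V E v0) (cover_edges V E v0) \<longrightarrow>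
           \<bar>edge_mean (lift_fun f) (edge_tube (cover_edges V E v0) r X) - edge_mean f E\<bar>
             \<le> C * L2_set f E * \<beta> ^ r)"
proof (cases "E = {}")
  case True
  \<comment> \<open>A single vertex; the cover has no edges either, and means over the empty set are \<open>0\<close>.\<close>
  have T: "cover_edges V {} v0 = {}" for v0
    using cover_edge_project[of _ _ V "{}" v0] by (fastforce simp: cover_edges_def)
  have "1 / real q \<in> {1 / real q} \<union> {real q powr (- 1 / 2)..<1}" by simp
  then show ?thesis
    by (intro exI[of _ 1] conjI allI bexI[of _ "1 / real q"])
      (auto simp: T True directed_edges_def edge_tube_def edge_mean_def)
next
  case False
  have q: "q \<ge> 2" using assms(6) by simp
  have finE: "finite E"
    using assms(1,2) by (intro finite_subset[of E "Pow V"]) (auto simp: simple_graph_def)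
  have card: "card (nbrs E v) = Suc q" if "v \<in> V" for v
  proof -
    obtain k where k: "\<And>v. v \<in> V \<Longrightarrow> vertex_degree E v = k"
      using assms(4) by (auto simp: regular_graph_def)
    obtain e where e: "e \<in> E" using False by blast
    then obtain u w where uw: "e = {u, w}" "u \<in> V" "w \<in> V"
      using assms(2) by (auto simp: simple_graph_def card_2_iff)
    then have "2 * q + 2 = k + k"
      using edge_degree_eq[OF finE assms(2), of u w] e assms(5) k by fastforce
    then show ?thesis using card_nbrs_eq_degree[OF assms(2)] k[OF that] by simp
  qed
  interpret finite_regular_graph V E q
    by unfold_locales (fact assms card q)+
  obtain \<beta> :: real where \<beta>: "real q powr (- 1 / 2) \<le> \<beta>" "\<beta> < 1"
    "\<And>g r a. even_balanced V E g \<Longrightarrow> a \<in> directed_edges E \<Longrightarrow>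
       \<bar>(nb_avg E q ^^ r) g a\<bar> \<le> real q * \<beta> ^ r * sqrt (energy V E g)"
    using nb_avg_decay by blast
  have "0 < real q powr (- 1 / 2)" using q by simp
  with \<beta>(1) have \<beta>0: "\<beta> > 0" by linarith
  have bound: "\<bar>(nb_avg E q ^^ r) (centred f) a\<bar> \<le> (2 * real q) * L2_set f E * \<beta> ^ r"
    if "a \<in> directed_edges E" for f r a
  proof -
    have "\<bar>(nb_avg E q ^^ r) (centred f) a\<bar> \<le> real q * \<beta> ^ r * sqrt (energy V E (centred f))"
      by (rule \<beta>(3)[OF even_balanced_centred that])
    also have "\<dots> \<le> real q * \<beta> ^ r * (2 * L2_set f E)"
      using \<beta>0 by (intro mult_left_mono energy_centred_le) auto
    finally show ?thesis by (simp add: mult_ac)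
  qed
  have arcs: "\<bar>arc_mean V E v0 r b f - edge_mean f E\<bar> \<le> (2 * real q) * L2_set f E * \<beta> ^ r"
    if v0: "v0 \<in> V" and b: "b \<in> lifts V E v0 a" for v0 a b f r
  proof -
    interpret tree: half_tree_graph "cover_verts V E v0" "cover_edges V E v0" cover_side
      by (rule cover_half_tree_graph[OF v0])
    obtain y z where yz: "b = (y, z)" by (cases b)
    have e: "{y, z} \<in> cover_edges V E v0"
      using b yz by (simp add: lifts_def directed_edges_def)
    have X: "finite_connected_subgraph {y} {} (cover_verts V E v0) (cover_edges V E v0)"
      using tree.edge_in_U[OF e] by (intro tree.singleton_subgraph) simp
    have S: "{b} \<subseteq> boundary (cover_edges V E v0) {y}"
      using e tree.edge_neq[OF e] yz by (auto simp: boundary_def)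
    show ?thesis
      using cover_level_mean[OF v0 X S _ _ bound] tree.edge_arc_eq[OF e] yz
      by (simp add: arc_mean_def)
  qed
  have tubes: "\<bar>edge_mean (lift_fun f) (edge_tube (cover_edges V E v0) r X) - edge_mean f E\<bar>
      \<le> (2 * real q) * L2_set f E * \<beta> ^ r"
    if v0: "v0 \<in> V"
      and X: "finite_connected_subgraph X F (cover_verts V E v0) (cover_edges V E v0)"
    for v0 X F f r
  proof (cases r)
    case 0
    \<comment> \<open>Edges inside \<open>X\<close> belong to this tube, so it is not a level; the trivial bound suffices.\<close>
    have f_le: "\<bar>f e\<bar> \<le> L2_set f E" if "e \<in> E" for e
      using member_le_L2_set[OF finE that, of "\<lambda>e. \<bar>f e\<bar>"] by (simp add: L2_set_def)
    have "\<bar>lift_fun f e\<bar> \<le> L2_set f E" if e: "e \<in> edge_tube (cover_edges V E v0) r X" for e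
    proof -
      obtain x y where "e = {x, y}" "{x, y} \<in> cover_edges V E v0"
        using e by (auto simp: edge_tube_def)
      then show ?thesis
        using f_le[OF cover_edge_project[of x y V E v0]] by (simp add: lift_fun_def)
    qed
    then have "\<bar>edge_mean (lift_fun f) (edge_tube (cover_edges V E v0) r X)\<bar> \<le> L2_set f E"
      by (rule abs_edge_mean_le) simp_all
    moreover have "\<bar>edge_mean f E\<bar> \<le> L2_set f E"
      using f_le by (rule abs_edge_mean_le) simp_all
    moreover have "2 * L2_set f E \<le> (2 * real q) * L2_set f E"
      using q by (intro mult_right_mono) auto
    ultimately have "\<bar>edge_mean (lift_fun f) (edge_tube (cover_edges V E v0) r X) - edge_mean f E\<bar>
        \<le> (2 * real q) * L2_set f E"
      using abs_triangle_ineq4[of "edge_mean (lift_fun f) (edge_tube (cover_edges V E v0) r X)"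
          "edge_mean f E"]
      by (smt (verit))
    then show ?thesis unfolding 0 by simp
  next
    case (Suc n)
    interpret tree: half_tree_graph "cover_verts V E v0" "cover_edges V E v0" cover_side
      by (rule cover_half_tree_graph[OF v0])
    have "finite X" "X \<noteq> {}" "X \<subseteq> cover_verts V E v0"
      using X by (auto simp: finite_connected_subgraph_def connected_graph_def)
    note bd = cover_boundary_finite_nonempty[OF this]
    show ?thesis
      unfolding Suc tree.edge_tube_Suc[OF X]
      by (rule cover_level_mean[OF v0 X subset_refl bd bound])
  qed
  show ?thesis
  proof (intro exI[of _ "2 * real q"] conjI allI bexI[of _ \<beta>] ballI impI)
    show "\<beta> \<in> {1 / real q} \<union> {real q powr (- 1 / 2)..<1}" using \<beta> by simp
    show "2 * real q > 0" using q by simp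
  qed (use arcs tubes in blast)+
qed

end
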